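(* Let $\mathbb{K}$ be a semiring and suppose that addition is $\boldsymbol{\mathcal{S}}$-recognizable, i.e., the set $\{(\boldsymbol{x},\boldsymbol{y},\boldsymbol{z})\in\mathbb{N}^{3d}:\boldsymbol{x}+\boldsymbol{y}=\boldsymbol{z}\}$ is $(\boldsymbol{\mathcal{S}},\boldsymbol{\mathcal{S}},\boldsymbol{\mathcal{S}})$-recognizable. Then for every $\boldsymbol{\mathcal{S}}$-automatic sequence $f\colon\mathbb{N}^d\to\mathbb{K}$, its factor complexity $\rho_f\colon\mathbb{N}^d\to\mathbb{N}$ is an $(\boldsymbol{\mathcal{S}},\mathbb{N})$-regular sequence.
   Context: An abstract numeration system is a triple $\mathcal{S}=(L,A,<)$ where $L$ is an infinite regular language over a finite alphabet $A$ totally ordered by $<$. Words are ordered by the radix order ($u<_{\rm rad}v$ iff $|u|<|v|$, or $|u|=|v|$ and $u$ is lexicographically smaller); $\mathrm{rep}_{\mathcal{S}}\colon\mathbb{N}\to L$ maps $n$ to the $n$-th word of $L$ (indexing from $0$) and $\mathrm{val}_{\mathcal{S}}$ is its inverse. For $e\ge1$, abstract numeration systems $\mathcal{T}_j=(K_j,B_j,<_j)$ and a symbol $\#\notin\bigcup_jB_j$, the $e$-dimensional system $\boldsymbol{\mathcal{T}}=(\mathcal{T}_1,\dots,\mathcal{T}_e)$ has alphabet $\boldsymbol{B}=\big((B_1\cup\{\#\})\times\cdots\times(B_e\cup\{\#\})\big)\setminus\{(\#,\dots,\#)\}$, numeration language $\boldsymbol{K}$ consisting of the words over $\boldsymbol{B}$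 obtained from $(w_1,\dots,w_e)\in K_1\times\cdots\times K_e$ by left-padding each $w_j$ with $\#$'s to the maximal length and reading them in parallel, and $\mathrm{rep}_{\boldsymbol{\mathcal{T}}}(n_1,\dots,n_e)$ is the word so obtained from $(\mathrm{rep}_{\mathcal{T}_1}(n_1),\dots,\mathrm{rep}_{\mathcal{T}_e}(n_e))$, a bijection $\mathbb{N}^e\to\boldsymbol{K}$ with inverse $\mathrm{val}_{\boldsymbol{\mathcal{T}}}$. A set $X\subseteq\mathbb{N}^e$ is $\boldsymbol{\mathcal{T}}$-recognizable if $\mathrm{rep}_{\boldsymbol{\mathcal{T}}}(X)$ is regular. $\boldsymbol{\mathcal{S}}=(\mathcal{S}_1,\dots,\mathcal{S}_d)$ is fixed, with alphabet $\boldsymbol{A}$; $(\boldsymbol{\mathcal{S}},\boldsymbol{\mathcal{S}},\boldsymbol{\mathcal{S}})$ is the $3d$-dimensional concatenated system. A sequence $f\colon\mathbb{N}^d\to\mathbb{K}$ is $\boldsymbol{\mathcal{S}}$-automatic if there is a deterministic finite automaton with output $(Q,q_0,\delta,\boldsymbol{A},\tau,\Delta)$ with finite output alphabet $\Delta\subseteq\mathbb{K}$ such that $f(\boldsymbol{n})=\tau(\delta(q_0,\mathrm{rep}_{\boldsymbol{\mathcal{S}}}(\boldsymbol{n})))$ for all $\boldsymbol{n}$. For $\boldsymbol{p},\boldsymbol{s}\in\mathbb{N}^d$, the factor $f[\boldsymbol{p},\boldsymbol{s}]$ is the map $[\![0,s_1-1]\!]\times\cdots\times[\![0,s_d-1]\!]\to\mathbb{K}$,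 $\boldsymbol{i}\mapsto f(\boldsymbol{p}+\boldsymbol{i})$; the factor complexity $\rho_f(\boldsymbol{s})$ is the number of distinct factors $f[\boldsymbol{p},\boldsymbol{s}]$, $\boldsymbol{p}\in\mathbb{N}^d$. A series $S\colon A^*\to\mathbb{N}$ is $\mathbb{N}$-recognizable if there exist $r\ge1$, a monoid morphism $\mu\colon A^*\to\mathbb{N}^{r\times r}$, $\lambda\in\mathbb{N}^{1\times r}$, $\gamma\in\mathbb{N}^{r\times1}$ with $(S,w)=\lambda\mu(w)\gamma$ for all $w$; a sequence $g\colon\mathbb{N}^d\to\mathbb{N}$ is $(\boldsymbol{\mathcal{S}},\mathbb{N})$-regular if $\sum_{\boldsymbol{w}\in\boldsymbol{L}}g(\mathrm{val}_{\boldsymbol{\mathcal{S}}}(\boldsymbol{w}))\,\boldsymbol{w}$ is $\mathbb{N}$-recognizable, $\boldsymbol{L}$ being the numeration language of $\boldsymbol{\mathcal{S}}$. *)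

theory Defs
  imports "HOL-Library.FuncSet" "Jordan_Normal_Form.Matrix"
begin

definition automaton :: "'b set \<Rightarrow> 'q set \<Rightarrow> 'q \<Rightarrow> ('q \<Rightarrow> 'b \<Rightarrow> 'q) \<Rightarrow> bool" where
  "automaton B Q q0 \<delta> \<longleftrightarrow>
     finite Q \<and> q0 \<in> Q \<and> (\<forall>q\<in>Q. \<forall>b\<in>B. \<delta> q b \<in> Q)"

text \<open>States are taken in \<^typ>\<open>nat\<close>, here and for automatic sequences: this loses nothing, as every
  finite automaton can be renamed to such a one.\<close>

definition regular_language :: "'b set \<Rightarrow> 'b list set \<Rightarrow> bool" where
  "regular_language B L \<longleftrightarrow>
     (\<exists>(Q :: nat set) q0 \<delta> F. automaton B Q q0 \<delta> \<and> F \<subseteq> Q \<and>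
        L = {w \<in> lists B. foldl \<delta> q0 w \<in> F})"

record 'a numeration =
  lang :: "'a list set"
  alphabet :: "'a set"
  less_letter :: "('a \<times> 'a) set"

definition numeration_system :: "'a numeration \<Rightarrow> bool" where
  "numeration_system S \<longleftrightarrow>
     finite (alphabet S) \<and>
     less_letter S \<subseteq> alphabet S \<times> alphabet S \<and>
     strict_linear_order_on (alphabet S) (less_letter S) \<and>
     regular_language (alphabet S) (lang S) \<and> infinite (lang S)"

text \<open>\<^term>\<open>lenlex\<close> is the radix order. The \<open>n\<close>-th word of the language, counting from 0, is the
  one with exactly \<open>n\<close> predecessors in the language; a word has only finitely many
  predecessors since the alphabet is finite.\<close>

definition rep1 :: "'a numeration \<Rightarrow> nat \<Rightarrow> 'a list" where
  "rep1 S n = (THE w. w \<in> lang S \<and>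
     card {u \<in> lang S. (u, w) \<in> lenlex (less_letter S)} = n)"

text \<open>An \<open>e\<close>-dimensional system is a family indexed by a finite type \<open>'e\<close> with \<open>e\<close> elements, and
  tuples of dimension \<open>e\<close> are functions on \<open>'e\<close>. All component alphabets are subsets of one type
  \<open>'a\<close>, and the padding symbol \<open>#\<close> is \<^const>\<open>None\<close>.\<close>

definition multi_alphabet :: "('e::finite \<Rightarrow> 'a numeration) \<Rightarrow> ('e \<Rightarrow> 'a option) set" where
  "multi_alphabet T = {b. \<forall>j. b j \<in> insert None (Some ` alphabet (T j))} - {\<lambda>j. None}"

definition pad :: "('e::finite \<Rightarrow> 'a list) \<Rightarrow> ('e \<Rightarrow> 'a option) list" where
  "pad w = (let m = Max (range (\<lambda>j. length (w j))) in
     map (\<lambda>i j. (replicate (m - length (w j)) None @ map Some (w j)) ! i) [0..<m])"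

definition multi_lang :: "('e::finite \<Rightarrow> 'a numeration) \<Rightarrow> ('e \<Rightarrow> 'a option) list set" where
  "multi_lang T = pad ` {w. \<forall>j. w j \<in> lang (T j)}"

definition rep :: "('e::finite \<Rightarrow> 'a numeration) \<Rightarrow> ('e \<Rightarrow> nat) \<Rightarrow> ('e \<Rightarrow> 'a option) list" where
  "rep T n = pad (\<lambda>j. rep1 (T j) (n j))"

text \<open>The inverse of the bijection \<^term>\<open>rep T\<close> from \<open>'e \<Rightarrow> nat\<close> onto \<^term>\<open>multi_lang T\<close>; only
  meaningful on \<^term>\<open>multi_lang T\<close>.\<close>

definition val :: "('e::finite \<Rightarrow> 'a numeration) \<Rightarrow> ('e \<Rightarrow> 'a option) list \<Rightarrow> ('e \<Rightarrow> nat)" where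
  "val T = the_inv (rep T)"

definition recognizable :: "('e::finite \<Rightarrow> 'a numeration) \<Rightarrow> ('e \<Rightarrow> nat) set \<Rightarrow> bool" where
  "recognizable T X \<longleftrightarrow> regular_language (multi_alphabet T) (rep T ` X)"

text \<open>The concatenation \<open>(x, y, z)\<close>, used both for triples of systems and for triples of vectors.\<close>

definition triple :: "('d \<Rightarrow> 'b) \<Rightarrow> ('d \<Rightarrow> 'b) \<Rightarrow> ('d \<Rightarrow> 'b) \<Rightarrow> ('d + 'd + 'd \<Rightarrow> 'b)" where
  "triple x y z = case_sum x (case_sum y z)"

definition addition_recognizable :: "('d::finite \<Rightarrow> 'a numeration) \<Rightarrow> bool" where
  "addition_recognizable S \<longleftrightarrow>
     recognizable (triple S S S) {triple x y z | x y z. \<forall>j. x j + y j = z j}"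

definition automatic :: "('d::finite \<Rightarrow> 'a numeration) \<Rightarrow> (('d \<Rightarrow> nat) \<Rightarrow> 'k) \<Rightarrow> bool" where
  "automatic S f \<longleftrightarrow>
     (\<exists>(Q :: nat set) q0 \<delta> \<tau> \<Delta>. automaton (multi_alphabet S) Q q0 \<delta> \<and>
        finite \<Delta> \<and> \<tau> \<in> Q \<rightarrow> \<Delta> \<and> (\<forall>n. f n = \<tau> (foldl \<delta> q0 (rep S n))))"

definition factor :: "(('d \<Rightarrow> nat) \<Rightarrow> 'k) \<Rightarrow> ('d \<Rightarrow> nat) \<Rightarrow> ('d \<Rightarrow> nat) \<Rightarrow> (('d \<Rightarrow> nat) \<Rightarrow> 'k)" where
  "factor f p s = restrict (\<lambda>i. f (\<lambda>j. p j + i j)) {i. \<forall>j. i j < s j}"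

text \<open>For automatic \<open>f\<close> the set of factors counted here is finite, because \<open>f\<close> has finite range.\<close>

definition factor_complexity :: "(('d::finite \<Rightarrow> nat) \<Rightarrow> 'k) \<Rightarrow> ('d \<Rightarrow> nat) \<Rightarrow> nat" where
  "factor_complexity f s = card (range (\<lambda>p. factor f p s))"

definition nat_recognizable :: "'b set \<Rightarrow> ('b list \<Rightarrow> nat) \<Rightarrow> bool" where
  "nat_recognizable B R \<longleftrightarrow>
     (\<exists>r (\<mu> :: 'b list \<Rightarrow> nat mat) l g. r \<ge> 1 \<and>
        (\<forall>w\<in>lists B. \<mu> w \<in> carrier_mat r r) \<and>
        \<mu> [] = 1\<^sub>m r \<and> (\<forall>u\<in>lists B. \<forall>v\<in>lists B. \<mu> (u @ v) = \<mu> u * \<mu> v) \<and>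
        l \<in> carrier_mat 1 r \<and> g \<in> carrier_mat r 1 \<and>
        (\<forall>w\<in>lists B. R w = (l * \<mu> w * g) $$ (0, 0)))"

definition nat_regular :: "('d::finite \<Rightarrow> 'a numeration) \<Rightarrow> (('d \<Rightarrow> nat) \<Rightarrow> nat) \<Rightarrow> bool" where
  "nat_regular S g \<longleftrightarrow>
     nat_recognizable (multi_alphabet S) (\<lambda>w. if w \<in> multi_lang S then g (val S w) else 0)"

end

theory Submission
  imports Defs
begin

text \<open>Relations between vectors that are first-order definable from addition, from the values of an
  automatic sequence and from a well-order read off the padded representations are recognizable. So is
  the relation between \<open>s\<close> and \<open>p\<close> saying that \<open>p\<close> is the first position at which its factor of
  size \<open>s\<close> occurs; the factor complexity of \<open>s\<close> counts these \<open>p\<close>, and counting the words above a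
  given track of a regular language is done by products of nonnegative integer matrices. Regularity
  is handled through the Myhill--Nerode criterion, which makes the closure properties short.\<close>

section \<open>Languages with finitely many left quotients\<close>

text \<open>Having finitely many left quotients makes sense over an infinite alphabet and survives
  letter-to-letter projections there. Hence a letter can carry a track for every natural number, and
  formulas need no list of their variables. When words are counted, the alphabet of the counted
  track is finite, and the quotients themselves index the matrices. Counting asks for one position
  per factor, hence for a well-order that can be read off the words. An injection \<open>N\<close>
  into the naturals provides it; compatibility with addition is not asked for. As \<open>f\<close>
  has finite range, the positions chosen for a given \<open>s\<close> are finitely many, but their
  representations may be longer than that of \<open>s\<close>. This difference of lengths is the
  recurring obstacle: a quantified or counted vector may need more columns than the word at hand
  has, and blanks must be added or stripped on the left.\<close>

definition quot :: "'b list set \<Rightarrow> 'b list \<Rightarrow> 'b list set" where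
  "quot L u = {v. u @ v \<in> L}"

definition fin_index :: "'b list set \<Rightarrow> bool" where
  "fin_index L \<longleftrightarrow> finite (range (quot L))"

lemma in_quot_iff [simp]: "v \<in> quot L u \<longleftrightarrow> u @ v \<in> L"
  by (simp add: quot_def)

lemma quot_append: "quot L (u @ v) = quot (quot L u) v"
  by (auto simp: quot_def)

lemma quot_Nil [simp]: "quot L [] = L"
  by (auto simp: quot_def)

text \<open>The subset construction: since \<open>F\<close> does not depend on \<open>u\<close>, a
  quotient of \<open>L'\<close> is determined by a set of quotients of \<open>L\<close>, and there
  are finitely many such sets. The sets \<open>X u\<close> may be infinite.\<close>

lemma fin_index_UnionI:
  assumes "fin_index L" "\<And>u. quot L' u = (\<Union>v\<in>X u. F (quot L v))"
  shows "fin_index L'"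
proof -
  have "range (quot L') \<subseteq> (\<lambda>Y. \<Union>D\<in>Y. F D) ` Pow (range (quot L))"
  proof
    fix D assume "D \<in> range (quot L')"
    then obtain u where "D = quot L' u" by blast
    then have "D = (\<Union>D\<in>quot L ` X u. F D)" using assms(2) by simp
    moreover have "quot L ` X u \<in> Pow (range (quot L))" by blast
    ultimately show "D \<in> (\<lambda>Y. \<Union>D\<in>Y. F D) ` Pow (range (quot L))" by (rule image_eqI)
  qed
  moreover have "finite (Pow (range (quot L)))" using assms(1) by (simp add: fin_index_def)
  ultimately show ?thesis unfolding fin_index_def by (rule finite_surj[rotated])
qed

lemma fin_index_Compl:
  assumes "fin_index L" shows "fin_index (- L)"
proof -
  have "range (quot (- L)) = uminus ` range (quot L)"
    by (auto simp: image_image quot_def intro!: image_cong)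
  then show ?thesis using assms by (simp add: fin_index_def)
qed

lemma fin_index_Int:
  assumes "fin_index L" "fin_index M" shows "fin_index (L \<inter> M)"
proof -
  have "range (quot (L \<inter> M)) \<subseteq> (\<lambda>(C, D). C \<inter> D) ` (range (quot L) \<times> range (quot M))"
  proof (rule image_subsetI)
    fix u
    have "quot (L \<inter> M) u = (case (quot L u, quot M u) of (C, D) \<Rightarrow> C \<inter> D)" by (auto simp: quot_def)
    then show "quot (L \<inter> M) u \<in> (\<lambda>(C, D). C \<inter> D) ` (range (quot L) \<times> range (quot M))"
      by (rule image_eqI) simp
  qed
  moreover have "finite (range (quot L) \<times> range (quot M))" using assms by (simp add: fin_index_def)
  ultimately show ?thesis unfolding fin_index_def by (rule finite_surj[rotated])
qed

lemma fin_index_Un: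
  assumes "fin_index L" "fin_index M" shows "fin_index (L \<union> M)"
  using fin_index_Compl[OF fin_index_Int[OF assms[THEN fin_index_Compl]]] by simp

lemma fin_index_empty: "fin_index {}"
  unfolding fin_index_def quot_def by simp

lemma fin_index_UN:
  assumes "finite I" "\<And>i. i \<in> I \<Longrightarrow> fin_index (L i)"
  shows "fin_index (\<Union>i\<in>I. L i)"
  using assms by (induction I rule: finite_induct) (auto intro: fin_index_Un fin_index_empty)

lemma fin_index_INT:
  assumes "finite I" "\<And>i. i \<in> I \<Longrightarrow> fin_index (L i)"
  shows "fin_index (\<Inter>i\<in>I. L i)"
  using fin_index_Compl[OF fin_index_UN[of I "\<lambda>i. - L i"]] assms by (simp add: fin_index_Compl)

lemma fin_index_vimage_map:
  assumes "fin_index L" shows "fin_index {w. map h w \<in> L}"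
proof (rule fin_index_UnionI[OF assms, where F = "\<lambda>D. {w. map h w \<in> D}" and X = "\<lambda>u. {map h u}"])
  fix u
  show "quot {w. map h w \<in> L} u = (\<Union>v\<in>{map h u}. {w. map h w \<in> quot L v})" by auto
qed

text \<open>Nondeterminism of a projection: after \<open>u\<close>, the word read in
  \<open>L\<close> can be any preimage of \<open>u\<close>.\<close>

lemma fin_index_image_map:
  assumes "fin_index L" shows "fin_index (map h ` L)"
proof (rule fin_index_UnionI[OF assms, where F = "\<lambda>D. map h ` D" and X = "\<lambda>u. {v. map h v = u}"])
  fix u
  show "quot (map h ` L) u = (\<Union>v\<in>{v. map h v = u}. map h ` quot L v)"
  proof (intro Set.set_eqI iffI)
    fix x assume "x \<in> quot (map h ` L) u"
    then obtain w where "w \<in> L" "u @ x = map h w" by auto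
    then obtain v y where "w = v @ y" "map h v = u" "map h y = x"
      by (auto simp: append_eq_map_conv)
    with \<open>w \<in> L\<close> show "x \<in> (\<Union>v\<in>{v. map h v = u}. map h ` quot L v)" by auto
  next
    fix x assume "x \<in> (\<Union>v\<in>{v. map h v = u}. map h ` quot L v)"
    then obtain v y where "map h v = u" "v @ y \<in> L" "x = map h y" by auto
    then show "x \<in> quot (map h ` L) u" by (metis image_eqI in_quot_iff map_append)
  qed
qed

lemma fin_index_unpad:
  assumes "fin_index L" shows "fin_index {w. \<exists>e. replicate e c @ w \<in> L}"
proof (rule fin_index_UnionI[OF assms, where F = "\<lambda>D. D" and X = "\<lambda>u. range (\<lambda>e. replicate e c @ u)"])
  fix u
  show "quot {w. \<exists>e. replicate e c @ w \<in> L} u = (\<Union>v\<in>range (\<lambda>e. replicate e c @ u). quot L v)"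
    by (auto simp: quot_def)
qed

text \<open>As long as only \<open>c\<close> has been read, nothing has changed; from the first
  other letter on, stripping is over and the word is read as by \<open>L\<close>.\<close>

lemma fin_index_strip:
  assumes "fin_index L" shows "fin_index {w. dropWhile ((=) c) w \<in> L}" (is "fin_index ?M")
proof -
  have "quot ?M u \<in> insert ?M (range (quot L))" for u
  proof (cases "\<forall>x\<in>set u. c = x")
    case True
    then have "dropWhile ((=) c) (u @ v) = dropWhile ((=) c) v" for v
      by (intro dropWhile_append2) blast
    then have "quot ?M u = ?M" by (simp add: quot_def)
    then show ?thesis by simp
  next
    case False
    then obtain x where "x \<in> set u" "c \<noteq> x" by blast
    then have "dropWhile ((=) c) (u @ v) = dropWhile ((=) c) u @ v" for v
      by (rule dropWhile_append1)
    then have "quot ?M u = quot L (dropWhile ((=) c) u)" by (simp add: quot_def)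
    then show ?thesis by simp
  qed
  then have "range (quot ?M) \<subseteq> insert ?M (range (quot L))" by (rule image_subsetI)
  then show ?thesis
    using assms unfolding fin_index_def by (simp add: finite_subset)
qed

lemma fin_index_ball_set: "fin_index {w. \<forall>x\<in>set w. P x}"
proof -
  have "range (quot {w. \<forall>x\<in>set w. P x}) \<subseteq> {{}, {w. \<forall>x\<in>set w. P x}}"
    by (auto simp: quot_def)
  then show ?thesis unfolding fin_index_def by (rule finite_subset) simp
qed

lemma fin_index_hd_neq: "fin_index {w. w = [] \<or> hd w \<noteq> c}" (is "fin_index ?M")
proof -
  have "quot ?M u \<in> {?M, UNIV, {}}" for u
    by (cases u) (auto simp: quot_def)
  then have "range (quot ?M) \<subseteq> {?M, UNIV, {}}" by (rule image_subsetI)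
  then show ?thesis unfolding fin_index_def by (rule finite_subset) simp
qed

lemma automaton_foldl:
  "automaton B Q q0 \<delta> \<Longrightarrow> q \<in> Q \<Longrightarrow> w \<in> lists B \<Longrightarrow> foldl \<delta> q w \<in> Q"
  by (induction w arbitrary: q) (auto simp: automaton_def)

text \<open>A quotient depends only on the state reached, and is empty once a letter outside
  \<open>B\<close> has occurred.\<close>

lemma fin_index_automaton:
  assumes "automaton B Q q0 \<delta>" shows "fin_index {w \<in> lists B. foldl \<delta> q0 w \<in> F}"
proof -
  let ?G = "\<lambda>q. {w \<in> lists B. foldl \<delta> q w \<in> F}"
  have "quot (?G q0) u \<in> insert {} (?G ` Q)" for u
  proof (cases "u \<in> lists B")
    case True
    then have "quot (?G q0) u = ?G (foldl \<delta> q0 u)" by auto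
    moreover have "foldl \<delta> q0 u \<in> Q"
      using automaton_foldl[OF assms] True assms by (auto simp: automaton_def)
    ultimately show ?thesis by blast
  next
    case False
    then have "quot (?G q0) u = {}" by auto
    then show ?thesis by simp
  qed
  then have "range (quot (?G q0)) \<subseteq> insert {} (?G ` Q)" by (rule image_subsetI)
  moreover have "finite Q" using assms by (simp add: automaton_def)
  ultimately show ?thesis unfolding fin_index_def by (simp add: finite_subset)
qed

lemma fin_index_regular_language: "regular_language B L \<Longrightarrow> fin_index L"
  unfolding regular_language_def by (auto intro: fin_index_automaton)

section \<open>Counting the words above a given projection\<close>

text \<open>The fixed length \<open>n\<close> of the second part determines where a word is cut, and
  disjointness of the \<open>X i\<close> then determines \<open>i\<close>. Only \<open>M\<close> is
  assumed finite, because an \<open>X i\<close> may be infinite when \<open>Y i\<close> is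
  empty.\<close>

lemma card_Union_append:
  assumes I: "finite I" and len: "\<And>i y. i \<in> I \<Longrightarrow> y \<in> Y i \<Longrightarrow> length y = n"
    and disj: "\<And>i j x. i \<in> I \<Longrightarrow> j \<in> I \<Longrightarrow> x \<in> X i \<Longrightarrow> x \<in> X j \<Longrightarrow> i = j"
    and M: "finite M" "\<And>z. z \<in> M \<longleftrightarrow> (\<exists>i\<in>I. \<exists>x\<in>X i. \<exists>y\<in>Y i. z = x @ y)"
  shows "card M = (\<Sum>i\<in>I. card (X i) * card (Y i))"
proof -
  let ?app = "\<lambda>(x, y). x @ y"
  have inj: "inj_on ?app (X i \<times> Y i)" if "i \<in> I" for i
    using len[OF that] by (auto simp: inj_on_def)
  have sub: "?app ` (X i \<times> Y i) \<subseteq> M" if "i \<in> I" for i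
    using that M(2) by auto
  have "M = (\<Union>i\<in>I. ?app ` (X i \<times> Y i))"
    using M(2) by (auto simp: image_iff)
  also have "card \<dots> = (\<Sum>i\<in>I. card (?app ` (X i \<times> Y i)))"
  proof (rule card_UN_disjoint[OF I])
    show "\<forall>i\<in>I. finite (?app ` (X i \<times> Y i))"
      using sub M(1) finite_subset by blast
    show "\<forall>i\<in>I. \<forall>j\<in>I. i \<noteq> j \<longrightarrow> ?app ` (X i \<times> Y i) \<inter> ?app ` (X j \<times> Y j) = {}"
    proof (intro ballI impI)
      fix i j assume ij: "i \<in> I" "j \<in> I" "i \<noteq> j"
      have False if "x \<in> X i" "y \<in> Y i" "x' \<in> X j" "y' \<in> Y j" "x @ y = x' @ y'" for x y x' y'
        using that len[OF ij(1), of y] len[OF ij(2), of y'] disj[OF ij(1,2), of x] ij(3) by auto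
      then show "?app ` (X i \<times> Y i) \<inter> ?app ` (X j \<times> Y j) = {}" by auto
    qed
  qed
  also have "\<dots> = (\<Sum>i\<in>I. card (X i) * card (Y i))"
    by (intro sum.cong) (auto simp: card_image inj card_cartesian_product)
  finally show ?thesis .
qed

text \<open>The \<open>c\<close>-prefixes account for the words whose second track is the longer one; a state reached
  by infinitely many such prefixes cannot contribute, so the junk value 0 of its cardinality is
  harmless.\<close>

lemma nat_recognizable_card_projection:
  fixes W :: "('b \<times> 'c) list set" and B' :: "'c set"
  assumes fi: "fin_index W" and B': "finite B'" and sub: "W \<subseteq> lists (UNIV \<times> B')"
    and fin: "\<And>w. finite {v \<in> W. \<exists>k. map fst v = replicate k c @ w}"
  shows "nat_recognizable B (\<lambda>w. card {v \<in> W. \<exists>k. map fst v = replicate k c @ w})"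
proof -
  define r where "r = card (range (quot W))"
  \<comment> \<open>The quotients are the states of the minimal automaton of \<open>W\<close>;
    \<open>e\<close> numbers them so that they can index matrices.\<close>
  obtain e where e: "bij_betw e {..<r} (range (quot W))"
    using fi unfolding fin_index_def r_def atLeast0LessThan[symmetric]
    using ex_bij_betw_nat_finite by blast
  have inj_e: "e i = e j \<longleftrightarrow> i = j" if "i < r" "j < r" for i j
    using e that by (auto simp: bij_betw_def inj_on_def)
  have e_ex: "\<exists>j<r. quot (e i) z = e j" if "i < r" for i z
  proof -
    have "e i \<in> range (quot W)" using e that by (auto simp: bij_betw_def)
    then have "quot (e i) z \<in> range (quot W)" by (auto simp: quot_append[symmetric])
    then show ?thesis using e unfolding bij_betw_def by (metis imageE lessThan_iff)
  qed
  have W_ex: "\<exists>j<r. quot W z = e j" for z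
    using e unfolding bij_betw_def by (metis imageE lessThan_iff rangeI)
  \<comment> \<open>The words leading from state \<open>e i\<close> to state \<open>e j\<close>
    whose first track is \<open>w\<close>; their number is the matrix entry.\<close>
  define Z where "Z i j w = {z \<in> lists (UNIV \<times> B'). map fst z = w \<and> quot (e i) z = e j}" for i j w
  have fin_lists: "finite {z \<in> lists (UNIV \<times> B'). map fst z = w}" for w :: "'b list"
  proof (rule finite_subset)
    show "{z \<in> lists (UNIV \<times> B'). map fst z = w}
        \<subseteq> {z. set z \<subseteq> set w \<times> B' \<and> length z = length w}"
      by force
    show "finite {z. set z \<subseteq> set w \<times> B' \<and> length z = length w}"
      by (intro finite_lists_length_eq) (simp add: B')
  qed
  have finZ: "finite (Z i j w)" for i j w
    unfolding Z_def by (rule finite_subset[OF _ fin_lists[of w]]) blast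
  define \<mu> where "\<mu> w = mat r r (\<lambda>(i, j). card (Z i j w))" for w
  have \<mu>_Nil: "\<mu> [] = 1\<^sub>m r"
  proof (rule eq_matI)
    fix i j assume "i < dim_row (1\<^sub>m r :: nat mat)" "j < dim_col (1\<^sub>m r :: nat mat)"
    moreover from this have "Z i j [] = (if i = j then {[]} else {})"
      using inj_e by (auto simp: Z_def)
    ultimately show "\<mu> [] $$ (i, j) = 1\<^sub>m r $$ (i, j)" by (auto simp: \<mu>_def)
  qed (auto simp: \<mu>_def)
  \<comment> \<open>Summing over the state reached after the part above \<open>u\<close> is exactly
    the matrix product.\<close>
  have card_Z_append: "card (Z i k (u @ v)) = (\<Sum>j<r. card (Z i j u) * card (Z j k v))"
    if i: "i < r" for i k u v
  proof (rule card_Union_append[where n = "length v"])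
    fix j y assume "y \<in> Z j k v"
    then show "length y = length v" by (auto simp: Z_def)
  next
    fix j j' x assume "j \<in> {..<r}" "j' \<in> {..<r}" "x \<in> Z i j u" "x \<in> Z i j' u"
    then show "j = j'" using inj_e[of j j'] by (simp add: Z_def)
  next
    fix z
    show "z \<in> Z i k (u @ v) \<longleftrightarrow> (\<exists>j\<in>{..<r}. \<exists>x\<in>Z i j u. \<exists>y\<in>Z j k v. z = x @ y)"
    proof
      assume z: "z \<in> Z i k (u @ v)"
      then obtain x y where xy: "z = x @ y" "map fst x = u" "map fst y = v"
        by (auto simp: Z_def map_eq_append_conv)
      moreover obtain j where "j < r" "quot (e i) x = e j" using e_ex[OF i] by blast
      ultimately have "x \<in> Z i j u" "y \<in> Z j k v" using z by (auto simp: Z_def quot_append)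
      then show "\<exists>j\<in>{..<r}. \<exists>x\<in>Z i j u. \<exists>y\<in>Z j k v. z = x @ y"
        using \<open>j < r\<close> xy(1) by blast
    next
      assume "\<exists>j\<in>{..<r}. \<exists>x\<in>Z i j u. \<exists>y\<in>Z j k v. z = x @ y"
      then show "z \<in> Z i k (u @ v)" by (auto simp: Z_def quot_append)
    qed
  qed (auto simp: finZ)
  have \<mu>_append: "\<mu> (u @ v) = \<mu> u * \<mu> v" for u v
    by (rule eq_matI) (auto simp: \<mu>_def scalar_prod_def card_Z_append atLeast0LessThan)
  define U where "U i = {u \<in> lists ({c} \<times> B'). quot W u = e i}" for i
  define V where "V i w = {z \<in> lists (UNIV \<times> B'). map fst z = w \<and> z \<in> e i}" for i w
  define l where "l = mat 1 r (\<lambda>(_, i). card (U i))"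
  define g where "g = mat r 1 (\<lambda>(j, _). if [] \<in> e j then 1 else (0 :: nat))"
  have card_V: "card (V i w) = (\<Sum>j<r. card (Z i j w) * (if [] \<in> e j then 1 else 0))"
    if i: "i < r" for i w
  proof -
    have "V i w = (\<Union>j\<in>{j \<in> {..<r}. [] \<in> e j}. Z i j w)"
    proof (intro Set.set_eqI iffI)
      fix z assume z: "z \<in> V i w"
      obtain j where j: "j < r" "quot (e i) z = e j" using e_ex[OF i] by blast
      then have "[] \<in> e j" using z by (simp add: V_def flip: j(2))
      then show "z \<in> (\<Union>j\<in>{j \<in> {..<r}. [] \<in> e j}. Z i j w)" using z j by (auto simp: V_def Z_def)
    next
      fix z assume "z \<in> (\<Union>j\<in>{j \<in> {..<r}. [] \<in> e j}. Z i j w)"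
      then obtain j where "[] \<in> e j" "z \<in> Z i j w" by auto
      then have "[] \<in> quot (e i) z" by (simp add: Z_def)
      then show "z \<in> V i w" using \<open>z \<in> Z i j w\<close> by (auto simp: V_def Z_def)
    qed
    also have "card \<dots> = (\<Sum>j\<in>{j \<in> {..<r}. [] \<in> e j}. card (Z i j w))"
    proof (rule card_UN_disjoint)
      show "\<forall>j\<in>{j \<in> {..<r}. [] \<in> e j}. \<forall>j'\<in>{j \<in> {..<r}. [] \<in> e j}.
          j \<noteq> j' \<longrightarrow> Z i j w \<inter> Z i j' w = {}"
        using inj_e by (auto simp: Z_def)
    qed (auto simp: finZ)
    also have "\<dots> = (\<Sum>j<r. card (Z i j w) * (if [] \<in> e j then 1 else 0))"
      by (subst sum.inter_filter) (auto intro!: sum.cong)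
    finally show ?thesis .
  qed
  \<comment> \<open>The cut before the last \<open>length w\<close> letters is forced. The prefixes
    in \<open>U i\<close> yield the initial row \<open>l\<close>, the accepted remainders in
    \<open>V i w\<close> yield \<open>\<mu> w * g\<close>.\<close>
  have count: "card {v \<in> W. \<exists>k. map fst v = replicate k c @ w} = (\<Sum>i<r. card (U i) * card (V i w))"
    for w
  proof (rule card_Union_append[where n = "length w"])
    fix i y assume "y \<in> V i w"
    then show "length y = length w" by (auto simp: V_def)
  next
    fix i j x assume "i \<in> {..<r}" "j \<in> {..<r}" "x \<in> U i" "x \<in> U j"
    then show "i = j" using inj_e[of i j] by (simp add: U_def)
  next
    fix z
    show "z \<in> {v \<in> W. \<exists>k. map fst v = replicate k c @ w} \<longleftrightarrow>
        (\<exists>i\<in>{..<r}. \<exists>x\<in>U i. \<exists>y\<in>V i w. z = x @ y)"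
    proof
      assume z: "z \<in> {v \<in> W. \<exists>k. map fst v = replicate k c @ w}"
      then obtain k where "map fst z = replicate k c @ w" by blast
      then obtain x y where xy: "z = x @ y" "map fst x = replicate k c" "map fst y = w"
        by (auto simp: map_eq_append_conv)
      have "z \<in> lists (UNIV \<times> B')" using z sub by blast
      then have Bxy: "x \<in> lists (UNIV \<times> B')" "y \<in> lists (UNIV \<times> B')" using xy(1) by auto
      moreover have "fst p = c" if "p \<in> set x" for p
        using arg_cong[OF xy(2), of set] that by (auto split: if_splits)
      ultimately have "x \<in> lists ({c} \<times> B')" by (auto simp: mem_Times_iff)
      moreover obtain i where i: "i < r" "quot W x = e i" using W_ex by blast
      moreover have "y \<in> quot W x" using z xy by simp
      ultimately have "x \<in> U i" "y \<in> V i w"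
        using xy Bxy by (simp_all add: U_def V_def)
      then show "\<exists>i\<in>{..<r}. \<exists>x\<in>U i. \<exists>y\<in>V i w. z = x @ y" using i(1) xy(1) by blast
    next
      assume "\<exists>i\<in>{..<r}. \<exists>x\<in>U i. \<exists>y\<in>V i w. z = x @ y"
      then obtain i x y where z: "z = x @ y" "x \<in> U i" "y \<in> V i w" by auto
      then have "y \<in> quot W x" by (simp add: U_def V_def)
      moreover have "map fst x = replicate (length x) c"
        using z(2) by (intro replicate_eqI) (auto simp: U_def)
      ultimately show "z \<in> {v \<in> W. \<exists>k. map fst v = replicate k c @ w}"
        using z by (auto simp: V_def)
    qed
  qed (auto simp: fin)
  have "r \<ge> 1"
    using fi by (auto simp: r_def fin_index_def Suc_le_eq card_gt_0_iff)
  moreover have "card {v \<in> W. \<exists>k. map fst v = replicate k c @ w} = (l * \<mu> w * g) $$ (0, 0)" for w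
  proof -
    have "l * \<mu> w * g = l * (\<mu> w * g)"
      by (rule assoc_mult_mat) (auto simp: l_def \<mu>_def g_def)
    also have "\<dots> $$ (0, 0) = (\<Sum>i<r. card (U i) * card (V i w))"
      by (simp add: l_def \<mu>_def g_def scalar_prod_def atLeast0LessThan card_V)
    finally show ?thesis by (simp add: count)
  qed
  ultimately show ?thesis
    unfolding nat_recognizable_def
    by (intro exI[of _ r] exI[of _ \<mu>] exI[of _ l] exI[of _ g])
      (auto simp: \<mu>_Nil \<mu>_append, auto simp: \<mu>_def l_def g_def)
qed

section \<open>Representations padded by leading blanks\<close>

lemma lex_total_on_lists:
  assumes "total_on A r" "u \<in> lists A" "v \<in> lists A" "length u = length v" "u \<noteq> v"
  shows "(u, v) \<in> lex r \<or> (v, u) \<in> lex r"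
  using assms(2-)
proof (induction u arbitrary: v rule: list.induct)
  case (Cons a u)
  then obtain b v' where v: "v = b # v'" by (cases v) auto
  show ?case
  proof (cases "a = b")
    case True
    then show ?thesis using Cons v by auto
  next
    case False
    then have "(a, b) \<in> r \<or> (b, a) \<in> r" using Cons.prems assms(1) v by (auto simp: total_on_def)
    then show ?thesis using Cons.prems v by auto
  qed
qed simp

text \<open>The number of predecessors in the language is strictly increasing along the radix order,
  which is total on the language, so \<open>rep1\<close> is its inverse once every number is
  attained.\<close>

lemma rep1_bij:
  assumes "numeration_system S"
  shows "bij_betw (rep1 S) UNIV (lang S)"
proof -
  define R where "R = lenlex (less_letter S)"
  define P where "P w = {u \<in> lang S. (u, w) \<in> R}" for w
  have A: "finite (alphabet S)" and sub: "lang S \<subseteq> lists (alphabet S)" and inf: "infinite (lang S)"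
    and ord: "strict_linear_order_on (alphabet S) (less_letter S)"
    using assms by (auto simp: numeration_system_def regular_language_def)
  have trans: "(u, w) \<in> R" if "(u, v) \<in> R" "(v, w) \<in> R" for u v w
    using that ord lenlex_trans unfolding R_def strict_linear_order_on_def by blast
  have irrefl: "(u, u) \<notin> R" for u
    using ord lenlex_irreflexive unfolding R_def strict_linear_order_on_def irrefl_def by blast
  have total: "(u, v) \<in> R \<or> (v, u) \<in> R" if "u \<in> lang S" "v \<in> lang S" "u \<noteq> v" for u v
  proof (cases "length u = length v")
    case True
    have "total_on (alphabet S) (less_letter S)" using ord by (simp add: strict_linear_order_on_def)
    from lex_total_on_lists[OF this, of u v] show ?thesis
      using that sub True by (auto simp: R_def lenlex_conv)
  next
    case False
    then show ?thesis by (auto simp: R_def lenlex_conv)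
  qed
  have finP: "finite (P w)" for w
  proof (rule finite_subset)
    show "P w \<subseteq> {u. set u \<subseteq> alphabet S \<and> length u \<le> length w}"
      using sub by (auto simp: P_def R_def dest: lenlex_length)
    show "finite {u. set u \<subseteq> alphabet S \<and> length u \<le> length w}"
      by (rule finite_lists_length_le[OF A])
  qed
  have mono: "card (P u) < card (P w)" if "u \<in> lang S" "(u, w) \<in> R" for u w
  proof (rule psubset_card_mono[OF finP])
    have "u \<in> P w" "u \<notin> P u" using that irrefl by (simp_all add: P_def)
    moreover have "P u \<subseteq> P w" using that(2) trans by (auto simp: P_def)
    ultimately show "P u \<subset> P w" by blast
  qed
  have inj: "inj_on (\<lambda>w. card (P w)) (lang S)"
  proof (rule inj_onI, rule ccontr)
    fix u v assume "u \<in> lang S" "v \<in> lang S" "card (P u) = card (P v)" "u \<noteq> v"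
    then show False using total[of u v] mono[of u v] mono[of v u] by auto
  qed
  \<comment> \<open>The values are unbounded, being infinitely many. Moreover the predecessors of
    \<open>w\<close> take \<open>card (P w)\<close> distinct values below \<open>card (P w)\<close>,
    hence all of them.\<close>
  have surj: "n \<in> (\<lambda>w. card (P w)) ` lang S" for n
  proof -
    have "infinite ((\<lambda>w. card (P w)) ` lang S)" using inf inj finite_imageD by blast
    then have "\<not> (\<lambda>w. card (P w)) ` lang S \<subseteq> {..n}" using finite_subset by blast
    then obtain w where w: "w \<in> lang S" "n < card (P w)"
      by (metis atMost_iff image_subsetI not_le)
    have "(\<lambda>w. card (P w)) ` P w = {..<card (P w)}"
    proof (rule card_subset_eq)
      show "(\<lambda>w. card (P w)) ` P w \<subseteq> {..<card (P w)}" using mono by (auto simp: P_def)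
      have "inj_on (\<lambda>w. card (P w)) (P w)" using inj by (rule inj_on_subset) (auto simp: P_def)
      then show "card ((\<lambda>w. card (P w)) ` P w) = card {..<card (P w)}" by (simp add: card_image)
    qed simp
    then have "n \<in> (\<lambda>w. card (P w)) ` P w" using w by simp
    then show ?thesis by (auto simp: P_def)
  qed
  have bij: "bij_betw (\<lambda>w. card (P w)) (lang S) UNIV"
    using inj surj unfolding bij_betw_def by blast
  have "rep1 S = the_inv_into (lang S) (\<lambda>w. card (P w))"
    by (rule ext) (simp add: rep1_def the_inv_into_def P_def R_def)
  then show ?thesis using bij_betw_the_inv_into[OF bij] by simp
qed

section \<open>Tracks and padded codes\<close>

abbreviation track :: "'v \<Rightarrow> ('v \<Rightarrow> 'b) list \<Rightarrow> 'b list" where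
  "track j \<equiv> map (\<lambda>l. l j)"

abbreviation blank :: "'e \<Rightarrow> 'a option" where
  "blank \<equiv> \<lambda>_. None"

text \<open>A word codes \<open>n\<close> if it is \<^term>\<open>rep T n\<close> with further blanks on the left. Stated track by
  track, this needs no reference to the maximal length.\<close>

definition codes :: "('e::finite \<Rightarrow> 'a numeration) \<Rightarrow> ('e \<Rightarrow> 'a option) list \<Rightarrow> ('e \<Rightarrow> nat) \<Rightarrow> bool" where
  "codes T y n \<longleftrightarrow> (\<forall>j. \<exists>m. track j y = replicate m None @ map Some (rep1 (T j) (n j)))"

lemma tracks_eqI:
  assumes "\<And>j. track j y = track j z" shows "y = z"
proof (rule nth_equalityI)
  show len: "length y = length z" using arg_cong[OF assms[of undefined], of length] by simp
  fix i assume "i < length y"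
  moreover from this have "track j y ! i = track j z ! i" for j using assms by simp
  ultimately show "y ! i = z ! i" using len by auto
qed

lemma length_rep: "length (rep T n) = Max (range (\<lambda>j. length (rep1 (T j) (n j))))"
  by (simp add: rep_def pad_def Let_def)

lemma length_rep1_le: "length (rep1 (T j) (n j)) \<le> length (rep T n)"
  by (simp add: length_rep)

lemma track_rep:
  "track j (rep T n) =
     replicate (length (rep T n) - length (rep1 (T j) (n j))) None @ map Some (rep1 (T j) (n j))"
proof -
  have "track j (rep T n) = map (\<lambda>i. (replicate (length (rep T n) - length (rep1 (T j) (n j))) None @
      map Some (rep1 (T j) (n j))) ! i) [0..<length (rep T n)]"
    unfolding length_rep by (simp add: rep_def pad_def Let_def)
  also have "\<dots> = replicate (length (rep T n) - length (rep1 (T j) (n j))) None @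
      map Some (rep1 (T j) (n j))"
    using length_rep1_le[of T j n]
    by (intro nth_equalityI) (simp_all del: map_append)
  finally show ?thesis .
qed

text \<open>The length of \<open>y\<close> bounds all component lengths, hence their maximum; the
  columns in excess of that maximum are blank in every track.\<close>

lemma codes_iff: "codes T y n \<longleftrightarrow> (\<exists>m. y = replicate m blank @ rep T n)"
proof
  assume c: "codes T y n"
  have tr: "track j y = replicate (length y - length (rep1 (T j) (n j))) None @
      map Some (rep1 (T j) (n j))" and le: "length (rep1 (T j) (n j)) \<le> length y" for j
  proof -
    obtain m where m: "track j y = replicate m None @ map Some (rep1 (T j) (n j))"
      using c by (auto simp: codes_def)
    from arg_cong[OF this, of length] have "length y = m + length (rep1 (T j) (n j))" by simp
    with m show "track j y = replicate (length y - length (rep1 (T j) (n j))) None @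
      map Some (rep1 (T j) (n j))" "length (rep1 (T j) (n j)) \<le> length y" by auto
  qed
  then have "length (rep T n) \<le> length y" by (simp add: length_rep)
  moreover have "y = replicate (length y - length (rep T n)) blank @ rep T n"
    using \<open>length (rep T n) \<le> length y\<close> length_rep1_le[of T _ n]
    by (intro tracks_eqI) (simp add: tr track_rep replicate_add[symmetric])
  ultimately show "\<exists>m. y = replicate m blank @ rep T n" by blast
next
  assume "\<exists>m. y = replicate m blank @ rep T n"
  then show "codes T y n"
    by (auto simp: codes_def track_rep replicate_add[symmetric] simp flip: append_assoc)
qed

lemma codes_rep: "codes T (rep T n) n"
  using codes_iff[of T "rep T n" n] by (metis append_Nil replicate_0)

text \<open>The track of a longest component has no padding, so every letter is non-blank
  there.\<close>

lemma blank_notin_rep: "blank \<notin> set (rep T n)"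
proof -
  have "Max (range (\<lambda>j. length (rep1 (T j) (n j)))) \<in> range (\<lambda>j. length (rep1 (T j) (n j)))"
    by (rule Max_in) auto
  then obtain j where "Max (range (\<lambda>j. length (rep1 (T j) (n j)))) = length (rep1 (T j) (n j))"
    by (rule rangeE)
  then have "length (rep T n) = length (rep1 (T j) (n j))" by (simp only: length_rep)
  then have "track j (rep T n) = map Some (rep1 (T j) (n j))" using track_rep[of j T n] by simp
  then have "set (track j (rep T n)) = set (map Some (rep1 (T j) (n j)))" by (rule arg_cong)
  then show ?thesis by auto
qed

lemma hd_rep: "rep T n \<noteq> [] \<Longrightarrow> hd (rep T n) \<noteq> blank"
  using blank_notin_rep[of T n] by (metis hd_in_set)

lemma dropWhile_replicate_append:
  "dropWhile ((=) c) (replicate m c @ w) = dropWhile ((=) c) w"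
  by (induction m) auto

lemma map_Some_the: "None \<notin> set d \<Longrightarrow> map Some (map the d) = d"
  by (induction d) auto

lemma codes_strip:
  assumes "codes T y n" shows "dropWhile ((=) blank) y = rep T n"
proof -
  have "dropWhile ((=) blank) (rep T n) = rep T n"
    using hd_rep[of T n] by (cases "rep T n") auto
  then show ?thesis using assms by (auto simp: codes_iff dropWhile_replicate_append)
qed

lemma track_strip:
  assumes "codes T y n"
  shows "dropWhile ((=) None) (track j y) = map Some (rep1 (T j) (n j))"
proof -
  have "dropWhile ((=) None) (map Some w) = map Some w" for w :: "'b list"
    by (cases w) auto
  then show ?thesis using assms[unfolded codes_def, rule_format, of j] by (auto simp: dropWhile_replicate_append)
qed

text \<open>At equal length a component determines its number of leading blanks, hence its track;
  conversely, stripping the blanks recovers \<open>rep1\<close>, which is injective.\<close>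

lemma track_eq_iff:
  assumes "\<And>j. numeration_system (T j)" "codes T y n" "codes T y' n'" "length y = length y'"
  shows "track j y = track j y' \<longleftrightarrow> n j = n' j"
proof
  assume "track j y = track j y'"
  then have "rep1 (T j) (n j) = rep1 (T j) (n' j)"
    using track_strip[OF assms(2), of j] track_strip[OF assms(3), of j] by simp
  then show "n j = n' j" using rep1_bij[OF assms(1)] by (auto simp: bij_betw_def inj_on_def)
next
  assume eq: "n j = n' j"
  obtain m m' where m: "track j y = replicate m None @ map Some (rep1 (T j) (n j))"
    "track j y' = replicate m' None @ map Some (rep1 (T j) (n j))"
    using assms(2,3)[unfolded codes_def, rule_format, of j] eq by auto
  from m[THEN arg_cong, of length]
  have "length y = m + length (rep1 (T j) (n j))" "length y' = m' + length (rep1 (T j) (n j))"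
    by simp_all
  then show "track j y = track j y'" using m assms(4) by simp
qed

lemma inj_rep:
  assumes "\<And>j. numeration_system (T j)" shows "inj (rep T)"
proof (rule injI, rule ext)
  fix n n' j assume "rep T n = rep T n'"
  moreover from this have "track j (rep T n) = track j (rep T n') \<longleftrightarrow> n j = n' j"
    by (intro track_eq_iff[of T] assms codes_rep) simp
  ultimately show "n j = n' j" by simp
qed

lemma val_rep: "(\<And>j. numeration_system (T j)) \<Longrightarrow> val T (rep T n) = n"
  by (simp add: val_def the_inv_f_f inj_rep)

lemma multi_lang_eq_range_rep:
  assumes "\<And>j. numeration_system (T j)" shows "multi_lang T = range (rep T)"
proof -
  have lang: "lang (T j) = range (rep1 (T j))" for j
    using rep1_bij[OF assms] by (auto simp: bij_betw_def)
  have "{w. \<forall>j. w j \<in> lang (T j)} = range (\<lambda>n j. rep1 (T j) (n j))"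
  proof (intro subset_antisym subsetI)
    fix w assume "w \<in> {w. \<forall>j. w j \<in> lang (T j)}"
    then have "\<forall>j. \<exists>n. w j = rep1 (T j) n" using lang by auto
    then obtain n where "\<forall>j. w j = rep1 (T j) (n j)" by metis
    then have "w = (\<lambda>j. rep1 (T j) (n j))" by auto
    then show "w \<in> range (\<lambda>n j. rep1 (T j) (n j))" by blast
  qed (auto simp: lang)
  then show ?thesis by (simp add: multi_lang_def image_image rep_def)
qed

text \<open>Unlike \<open>multi_alphabet\<close>, this contains the all-blank letter, which occurs
  in padded codes.\<close>

definition letters :: "('e::finite \<Rightarrow> 'a numeration) \<Rightarrow> ('e \<Rightarrow> 'a option) set" where
  "letters T = {b. \<forall>j. b j \<in> insert None (Some ` alphabet (T j))}"

lemma finite_letters: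
  assumes "\<And>j. numeration_system (T j)" shows "finite (letters T)"
proof -
  have "letters T = Pi\<^sub>E UNIV (\<lambda>j. insert None (Some ` alphabet (T j)))"
    by (auto simp: letters_def PiE_UNIV_domain)
  moreover have "finite (alphabet (T j))" for j using assms by (simp add: numeration_system_def)
  ultimately show ?thesis by (simp add: finite_PiE)
qed

lemma codes_letters:
  assumes "\<And>j. numeration_system (T j)" "codes T y n" shows "set y \<subseteq> letters T"
proof
  fix b assume b: "b \<in> set y"
  have "b j \<in> insert None (Some ` alphabet (T j))" for j
  proof -
    have "rep1 (T j) (n j) \<in> lang (T j)" using rep1_bij[OF assms(1)] by (auto simp: bij_betw_def)
    then have "set (rep1 (T j) (n j)) \<subseteq> alphabet (T j)"
      using assms(1)[of j] by (auto simp: numeration_system_def regular_language_def)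
    moreover have "b j \<in> set (track j y)" using b by auto
    moreover obtain m where "track j y = replicate m None @ map Some (rep1 (T j) (n j))"
      using assms(2) by (auto simp: codes_def)
    ultimately show ?thesis by (auto split: if_splits)
  qed
  then show "b \<in> letters T" by (simp add: letters_def)
qed

lemma codes_unique:
  assumes "\<And>j. numeration_system (T j)" "codes T y n" "codes T y n'" shows "n = n'"
  using track_eq_iff[OF assms(1,2,3)] by auto

lemma rep_in_lists:
  assumes "\<And>j. numeration_system (T j)" shows "rep T n \<in> lists (multi_alphabet T)"
proof -
  have "multi_alphabet T = letters T - {blank}" by (simp add: multi_alphabet_def letters_def)
  then show ?thesis
    using codes_letters[OF assms codes_rep[of T n]] blank_notin_rep[of T n] by auto
qed

text \<open>Validity is a condition on each track separately, so it is a finite intersection of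
  stripped and relabelled copies of the component languages.\<close>

lemma fin_index_codes:
  assumes "\<And>j. numeration_system (T j)" shows "fin_index {y. \<exists>n. codes T y n}"
proof -
  \<comment> \<open>\<open>map the\<close> is meaningful only on words without \<open>None\<close>,
    so blanks inside a representation are excluded explicitly.\<close>
  let ?L = "\<lambda>j. {w. None \<notin> set w \<and> map the w \<in> lang (T j)}"
  have "{y. \<exists>n. codes T y n} = (\<Inter>j\<in>UNIV. {y. track j y \<in> {w. dropWhile ((=) None) w \<in> ?L j}})"
  proof (intro subset_antisym subsetI INT_I; clarsimp)
    fix y n j assume "codes T y n"
    moreover have "rep1 (T j) (n j) \<in> lang (T j)" using rep1_bij[OF assms] by (auto simp: bij_betw_def)
    ultimately show "None \<notin> set (dropWhile ((=) None) (track j y)) \<and>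
        map the (dropWhile ((=) None) (track j y)) \<in> lang (T j)"
      by (simp add: track_strip image_iff comp_def)
  next
    fix y assume y: "\<forall>j. None \<notin> set (dropWhile ((=) None) (track j y)) \<and>
        map the (dropWhile ((=) None) (track j y)) \<in> lang (T j)"
    have "\<exists>n m. track j y = replicate m None @ map Some (rep1 (T j) n)" for j
    proof -
      let ?d = "dropWhile ((=) None) (track j y)" and ?t = "takeWhile ((=) None) (track j y)"
      have "map the ?d \<in> range (rep1 (T j))"
        using y rep1_bij[OF assms, of j] by (simp add: bij_betw_def)
      then obtain n where "map the ?d = rep1 (T j) n" by (rule rangeE)
      moreover have "map Some (map the ?d) = ?d"
        using y by (intro map_Some_the) blast
      moreover have "?t = replicate (length ?t) None"
        by (intro replicate_eqI) (auto dest: set_takeWhileD)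
      ultimately have "?t @ ?d = replicate (length ?t) None @ map Some (rep1 (T j) n)" by simp
      then show ?thesis unfolding takeWhile_dropWhile_id by blast
    qed
    then show "\<exists>n. codes T y n" unfolding codes_def by metis
  qed
  moreover have "fin_index (?L j)" for j
  proof -
    have "fin_index (lang (T j))"
      using assms[of j] by (auto simp: numeration_system_def intro: fin_index_regular_language)
    then have "fin_index ({w. \<forall>x\<in>set w. x \<noteq> None} \<inter> {w. map the w \<in> lang (T j)})"
      by (intro fin_index_Int fin_index_ball_set fin_index_vimage_map)
    moreover have "{w. \<forall>x\<in>set w. x \<noteq> None} \<inter> {w. map the w \<in> lang (T j)} = ?L j"
      by (simp add: set_eq_iff) (metis not_None_eq)
    ultimately show ?thesis by simp
  qed
  ultimately show ?thesis
    by (simp only:) (intro fin_index_INT finite_UNIV fin_index_vimage_map fin_index_strip)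
qed

section \<open>First-order definable relations\<close>

text \<open>Variables are natural numbers; a letter carries one track for each of them. Nothing is required
  of the acceptor on words with a track that is not a padded representation, so that complements are
  free and only the existential quantifier has to enforce validity.\<close>

definition acceptable :: "('d::finite \<Rightarrow> 'a numeration) \<Rightarrow> ((nat \<Rightarrow> 'd \<Rightarrow> nat) \<Rightarrow> bool) \<Rightarrow> bool" where
  "acceptable S R \<longleftrightarrow> (\<exists>P. fin_index P \<and>
     (\<forall>w x. (\<forall>k. codes S (track k w) (x k)) \<longrightarrow> (w \<in> P \<longleftrightarrow> R x)))"

lemma acceptableI:
  assumes "fin_index P" "\<And>w x. (\<And>k. codes S (track k w) (x k)) \<Longrightarrow> w \<in> P \<longleftrightarrow> R x"
  shows "acceptable S R"
  using assms unfolding acceptable_def by blast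

lemma acceptable_Not: "acceptable S R \<Longrightarrow> acceptable S (\<lambda>x. \<not> R x)"
proof -
  assume "acceptable S R"
  then obtain P where "fin_index P" "\<And>w x. (\<forall>k. codes S (track k w) (x k)) \<Longrightarrow> w \<in> P \<longleftrightarrow> R x"
    unfolding acceptable_def by blast
  then show ?thesis by (intro acceptableI[of "- P"]) (auto simp: fin_index_Compl)
qed

lemma acceptable_conj:
  fixes S :: "'d::finite \<Rightarrow> 'a numeration"
  assumes "acceptable S R" "acceptable S R'" shows "acceptable S (\<lambda>x. R x \<and> R' x)"
proof -
  obtain P where P: "fin_index P" "\<And>w x. (\<forall>k. codes S (track k w) (x k)) \<Longrightarrow> w \<in> P \<longleftrightarrow> R x"
    using assms(1) unfolding acceptable_def by blast
  obtain P' where P': "fin_index P'" "\<And>w x. (\<forall>k. codes S (track k w) (x k)) \<Longrightarrow> w \<in> P' \<longleftrightarrow> R' x"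
    using assms(2) unfolding acceptable_def by blast
  show ?thesis
  proof (rule acceptableI)
    show "fin_index (P \<inter> P')" using P(1) P'(1) by (rule fin_index_Int)
    fix w and x :: "nat \<Rightarrow> 'd \<Rightarrow> nat" assume "\<And>k. codes S (track k w) (x k)"
    then show "w \<in> P \<inter> P' \<longleftrightarrow> R x \<and> R' x" using P(2)[of w x] P'(2)[of w x] by simp
  qed
qed

lemma acceptable_ball:
  assumes "finite I" "\<And>i. i \<in> I \<Longrightarrow> acceptable S (R i)"
  shows "acceptable S (\<lambda>x. \<forall>i\<in>I. R i x)"
  using assms
proof (induction I rule: finite_induct)
  case empty
  have "acceptable S (\<lambda>x. True)"
    by (rule acceptableI[of UNIV]) (use fin_index_Compl[OF fin_index_empty] in auto)
  then show ?case by simp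
next
  case (insert i I)
  then show ?case by (simp add: acceptable_conj)
qed

text \<open>Track \<open>k\<close> is erased and guessed anew. A witness longer than
  \<open>w\<close> needs additional columns, blank in the other tracks, and
  \<open>fin_index_unpad\<close> absorbs them.\<close>

lemma acceptable_ex:
  fixes S :: "'a::finite \<Rightarrow> 'b numeration"
  assumes S: "\<And>j. numeration_system (S j)" and R: "acceptable S R"
  shows "acceptable S (\<lambda>x. \<exists>y. R (x(k := y)))"
proof -
  obtain P where P: "fin_index P" "\<And>w x. (\<forall>k. codes S (track k w) (x k)) \<Longrightarrow> w \<in> P \<longleftrightarrow> R x"
    using R unfolding acceptable_def by blast
  define c :: "nat \<Rightarrow> 'a \<Rightarrow> 'b option" where "c = (\<lambda>_. blank)"
  \<comment> \<open>Blanking the track instead of deleting it keeps the type of letters; equality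
    under \<open>h\<close> means agreement outside track \<open>k\<close>.\<close>
  define h :: "(nat \<Rightarrow> 'a \<Rightarrow> 'b option) \<Rightarrow> _" where "h = (\<lambda>l. l(k := blank))"
  \<comment> \<open>\<open>P\<close> is unconstrained on words with an invalid track, so the guessed
    track must be forced to code some vector. The other tracks inherit validity from
    \<open>w\<close>.\<close>
  define P1 where "P1 = P \<inter> {w. track k w \<in> {y. \<exists>n. codes S y n}}"
  define P2 where "P2 = {w. \<exists>e. replicate e c @ w \<in> {w. map h w \<in> map h ` P1}}"
  have "fin_index P2"
    unfolding P2_def P1_def
    by (intro fin_index_unpad fin_index_vimage_map fin_index_image_map fin_index_Int P(1)
        fin_index_codes S)
  moreover have "w \<in> P2 \<longleftrightarrow> (\<exists>y. R (x(k := y)))" if w: "\<And>k. codes S (track k w) (x k)" for w x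
  proof
    assume "w \<in> P2"
    then obtain e w' where w': "w' \<in> P1" "map h (replicate e c @ w) = map h w'"
      by (auto simp: P2_def)
    then obtain y where y: "codes S (track k w') y" by (auto simp: P1_def)
    have "codes S (track i w') ((x(k := y)) i)" for i
    proof (cases "i = k")
      case False
      then have tr: "track i v = track i (map h v)" for v by (simp add: h_def)
      have "track i w' = track i (replicate e c @ w)" using w'(2) tr by metis
      then have "track i w' = replicate e blank @ track i w" by (simp add: c_def)
      moreover obtain m where "track i w = replicate m blank @ rep S (x i)"
        using w[of i] unfolding codes_iff by blast
      ultimately have "track i w' = replicate (e + m) blank @ rep S (x i)"
        by (simp add: replicate_add)
      then have "codes S (track i w') (x i)" unfolding codes_iff by blast
      then show ?thesis using False by simp
    qed (simp add: y)
    then show "\<exists>y. R (x(k := y))" using P(2)[of w' "x(k := y)"] w'(1) by (auto simp: P1_def)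
  next
    assume "\<exists>y. R (x(k := y))"
    then obtain y where y: "R (x(k := y))" by blast
    \<comment> \<open>By truncated subtraction at most one of the two paddings is nonempty: either
      \<open>w\<close> is extended to the length of \<open>rep S y\<close>, or the reverse.\<close>
    define e where "e = length (rep S y) - length w"
    define u where "u = replicate (length w - length (rep S y)) blank @ rep S y"
    define w' where "w' = map2 (\<lambda>l b. l(k := b)) (replicate e c @ w) u"
    have len: "length u = e + length w" by (simp add: u_def e_def)
    have "track k w' = u"
      by (rule nth_equalityI) (simp_all add: w'_def len)
    then have k: "codes S (track k w') y" unfolding codes_iff u_def by blast
    have "codes S (track i w') ((x(k := y)) i)" for i
    proof (cases "i = k")
      case False
      then have "track i w' = track i (replicate e c @ w)"
        by (intro nth_equalityI) (simp_all add: w'_def len del: map_append)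
      then have "track i w' = replicate e blank @ track i w" by (simp add: c_def)
      moreover obtain m where "track i w = replicate m blank @ rep S (x i)"
        using w[of i] unfolding codes_iff by blast
      ultimately have "track i w' = replicate (e + m) blank @ rep S (x i)"
        by (simp add: replicate_add)
      then have "codes S (track i w') (x i)" unfolding codes_iff by blast
      then show ?thesis using False by simp
    qed (simp add: k)
    then have "w' \<in> P1" using P(2)[of w' "x(k := y)"] y k by (auto simp: P1_def)
    moreover have "map h (replicate e c @ w) = map h w'"
      by (rule nth_equalityI) (simp_all add: w'_def len h_def del: map_append)
    ultimately show "w \<in> P2" unfolding P2_def by blast
  qed
  ultimately show ?thesis by (rule acceptableI)
qed

section \<open>Atomic relations: addition, comparison, values of an automatic sequence\<close>

lemma acceptable_add:
  fixes S :: "'a::finite \<Rightarrow> 'b numeration"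
  assumes S: "\<And>j. numeration_system (S j)" and add: "addition_recognizable S"
  shows "acceptable S (\<lambda>x. \<forall>j. x a j + x b j = x c j)"
proof -
  let ?X = "{triple x y z | x y z. \<forall>j. x j + y j = z j}"
  let ?T = "triple S S S"
  define h where "h = (\<lambda>l :: nat \<Rightarrow> 'a \<Rightarrow> 'b option. triple (l a) (l b) (l c))"
  have T: "numeration_system (?T j)" for j
    using S by (auto simp: triple_def split: sum.split)
  have "fin_index (rep ?T ` ?X)"
    using add fin_index_regular_language unfolding addition_recognizable_def recognizable_def by blast
  \<comment> \<open>Representations never contain a column blank in all three tracks, whereas the
    selected tracks of \<open>w\<close> may share leading ones.\<close>
  then have "fin_index {w. map h w \<in> {w. dropWhile ((=) blank) w \<in> rep ?T ` ?X}}"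
    by (intro fin_index_vimage_map fin_index_strip)
  moreover have "w \<in> {w. map h w \<in> {w. dropWhile ((=) blank) w \<in> rep ?T ` ?X}} \<longleftrightarrow>
      (\<forall>j. x a j + x b j = x c j)" if w: "\<And>k. codes S (track k w) (x k)" for w x
  proof -
    have "\<exists>m. track j (map h w) =
        replicate m None @ map Some (rep1 (?T j) (triple (x a) (x b) (x c) j))" for j
    proof -
      have tr: "\<exists>m. map (\<lambda>l. l k i) w = replicate m None @ map Some (rep1 (S i) (x k i))" for k i
        using w[of k] by (simp add: codes_def comp_def)
      show ?thesis
        using tr by (cases j; cases "projr j") (auto simp: triple_def h_def comp_def)
    qed
    then have "codes ?T (map h w) (triple (x a) (x b) (x c))" unfolding codes_def by blast
    from codes_strip[OF this]
    have "w \<in> {w. map h w \<in> {w. dropWhile ((=) blank) w \<in> rep ?T ` ?X}} \<longleftrightarrow>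
        rep ?T (triple (x a) (x b) (x c)) \<in> rep ?T ` ?X" by simp
    also have "\<dots> \<longleftrightarrow> triple (x a) (x b) (x c) \<in> ?X"
      by (rule inj_image_mem_iff[OF inj_rep[OF T]])
    also have "\<dots> \<longleftrightarrow> (\<forall>j. x a j + x b j = x c j)"
    proof -
      have "triple u v z = triple u' v' z' \<longleftrightarrow> u = u' \<and> v = v' \<and> z = z'" for u v z u' v' z' :: "'a \<Rightarrow> nat"
        unfolding triple_def by (metis case_sum_o_inj)
      then show ?thesis by auto
    qed
    finally show ?thesis .
  qed
  ultimately show ?thesis by (rule acceptableI)
qed

text \<open>Tracks of one word have equal length, so coordinates are compared letter by
  letter.\<close>

lemma acceptable_neq_coordinate:
  fixes S :: "'a::finite \<Rightarrow> 'b numeration"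
  assumes S: "\<And>j. numeration_system (S j)"
  shows "acceptable S (\<lambda>x. x a j \<noteq> x b j)"
proof (rule acceptableI)
  have "fin_index (- {w. \<forall>l\<in>set w. l a j = l b j})"
    by (intro fin_index_Compl fin_index_ball_set)
  then show "fin_index (- {w :: (nat \<Rightarrow> 'a \<Rightarrow> 'b option) list. \<forall>l\<in>set w. l a j = l b j})" .
  fix w and x :: "nat \<Rightarrow> 'a \<Rightarrow> nat" assume w: "\<And>k. codes S (track k w) (x k)"
  have "(\<forall>l\<in>set w. l a j = l b j) \<longleftrightarrow> track j (track a w) = track j (track b w)" by simp
  also have "\<dots> \<longleftrightarrow> x a j = x b j" by (intro track_eq_iff[OF S w w]) simp
  finally show "w \<in> - {w. \<forall>l\<in>set w. l a j = l b j} \<longleftrightarrow> x a j \<noteq> x b j" by simp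
qed

text \<open>Some difference exists and no coordinate agrees. The variable \<open>c\<close> is bound
  to the difference, so it must be distinct from \<open>a\<close> and \<open>b\<close>.\<close>

lemma acceptable_less:
  fixes S :: "'a::finite \<Rightarrow> 'b numeration"
  assumes S: "\<And>j. numeration_system (S j)" and add: "addition_recognizable S" and "c \<noteq> a" "c \<noteq> b"
  shows "acceptable S (\<lambda>x. \<forall>j. x a j < x b j)"
proof -
  have "acceptable S (\<lambda>x. (\<exists>y. \<forall>j. (x(c := y)) a j + (x(c := y)) c j = (x(c := y)) b j) \<and>
      (\<forall>j\<in>UNIV. x a j \<noteq> x b j))"
    by (intro acceptable_conj acceptable_ex acceptable_ball acceptable_neq_coordinate finite_UNIV
        acceptable_add S add)
  moreover have "(\<exists>y. \<forall>j. u j + y j = v j) \<and> (\<forall>j. u j \<noteq> v j) \<longleftrightarrow> (\<forall>j. u j < v j)"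
    for u v :: "'a \<Rightarrow> nat"
  proof
    assume "(\<exists>y. \<forall>j. u j + y j = v j) \<and> (\<forall>j. u j \<noteq> v j)"
    then show "\<forall>j. u j < v j" by (metis le_add1 le_neq_implies_less)
  next
    assume "\<forall>j. u j < v j"
    then show "(\<exists>y. \<forall>j. u j + y j = v j) \<and> (\<forall>j. u j \<noteq> v j)"
      by (intro conjI exI[of _ "\<lambda>j. v j - u j"]) (auto simp: less_imp_le less_imp_neq)
  qed
  ultimately show ?thesis using assms(3,4) by simp
qed

lemma automatic_finite_range:
  assumes "\<And>j. numeration_system (S j)" "automatic S f" shows "finite (range f)"
proof -
  obtain Q :: "nat set" and q0 \<delta> \<tau> where
    aut: "automaton (multi_alphabet S) Q q0 \<delta>" and f: "\<And>n. f n = \<tau> (foldl \<delta> q0 (rep S n))"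
    using assms(2) unfolding automatic_def by blast
  have "range f \<subseteq> \<tau> ` Q"
    using automaton_foldl[OF aut _ rep_in_lists[of S, OF assms(1)]] aut
    by (auto simp: f automaton_def)
  moreover have "finite Q" using aut by (simp add: automaton_def)
  ultimately show ?thesis by (meson finite_imageI finite_subset)
qed

lemma acceptable_automatic_eq:
  fixes S :: "'d::finite \<Rightarrow> 'a numeration"
  assumes "\<And>j. numeration_system (S j)" "automatic S f" shows "acceptable S (\<lambda>x. f (x a) = c)"
proof -
  obtain Q :: "nat set" and q0 \<delta> \<tau> where
    aut: "automaton (multi_alphabet S) Q q0 \<delta>" and f: "\<And>n. f n = \<tau> (foldl \<delta> q0 (rep S n))"
    using assms(2) unfolding automatic_def by blast
  let ?L = "{v \<in> lists (multi_alphabet S). foldl \<delta> q0 v \<in> {q. \<tau> q = c}}"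
  show ?thesis
  proof (rule acceptableI)
    show "fin_index {w. track a w \<in> {y. dropWhile ((=) blank) y \<in> ?L}}"
      by (intro fin_index_vimage_map fin_index_strip fin_index_automaton[OF aut])
    fix w and x :: "nat \<Rightarrow> 'd \<Rightarrow> nat" assume "\<And>k. codes S (track k w) (x k)"
    then have "dropWhile ((=) blank) (track a w) = rep S (x a)" by (intro codes_strip)
    then show "w \<in> {w. track a w \<in> {y. dropWhile ((=) blank) y \<in> ?L}} \<longleftrightarrow> f (x a) = c"
      using rep_in_lists[of S, OF assms(1)] by (simp add: f)
  qed
qed

text \<open>The finite range of \<open>f\<close> turns the comparison of two values into a finite
  disjunction over the first value.\<close>

lemma acceptable_automatic_neq:
  assumes "\<And>j. numeration_system (S j)" "automatic S f"
  shows "acceptable S (\<lambda>x. f (x a) \<noteq> f (x b))"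
proof -
  have "acceptable S (\<lambda>x. \<not> (\<forall>c\<in>range f. \<not> (f (x a) = c \<and> \<not> f (x b) = c)))"
    by (intro acceptable_Not acceptable_ball acceptable_conj acceptable_automatic_eq
        automatic_finite_range[of S] assms)
  moreover have "(\<lambda>x. \<not> (\<forall>c\<in>range f. \<not> (f (x a) = c \<and> \<not> f (x b) = c))) = (\<lambda>x. f (x a) \<noteq> f (x b))"
    by auto
  ultimately show ?thesis by simp
qed

section \<open>An acceptable well-order\<close>

text \<open>Horner's rule in base \<open>K\<close> with digits \<open>g\<close>, most significant
  digit first.\<close>

definition numval :: "('b \<Rightarrow> nat) \<Rightarrow> nat \<Rightarrow> 'b list \<Rightarrow> nat" where
  "numval g K = foldl (\<lambda>s b. s * K + g b) 0"

lemma numval_Nil [simp]: "numval g K [] = 0"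
  by (simp add: numval_def)

lemma numval_snoc [simp]: "numval g K (y @ [b]) = numval g K y * K + g b"
  by (simp add: numval_def)

lemma numval_append: "numval g K (u @ v) = numval g K u * K ^ length v + numval g K v"
proof (induction v rule: rev_induct)
  case (snoc b v)
  have "numval g K (u @ v @ [b]) = numval g K (u @ v) * K + g b"
    by (metis append_assoc numval_snoc)
  then show ?case using snoc by (simp add: algebra_simps)
qed simp

lemma numval_less:
  assumes "\<And>b. g b < K" shows "numval g K y < K ^ length y"
proof (induction y rule: rev_induct)
  case (snoc b y)
  have "numval g K y * K + g b < (numval g K y + 1) * K" using assms[of b] by simp
  also have "\<dots> \<le> K ^ length y * K" using snoc by (intro mult_right_mono) auto
  finally show ?case by (simp add: mult.commute)
qed simp

lemma numval_inj:
  assumes K: "\<And>b. g b < K" and g: "inj_on g A"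
    and "length y = length z" "set y \<subseteq> A" "set z \<subseteq> A" "numval g K y = numval g K z"
  shows "y = z"
  using assms(3-)
proof (induction y arbitrary: z rule: rev_induct)
  case (snoc b y)
  then obtain c z' where z: "z = z' @ [c]" by (cases z rule: rev_cases) auto
  have eq: "numval g K y * K + g b = numval g K z' * K + g c" using snoc.prems z by simp
  have "g b = g c" using arg_cong[OF eq, of "\<lambda>n. n mod K"] K[of b] K[of c] by simp
  moreover have "numval g K y = numval g K z'"
    using arg_cong[OF eq, of "\<lambda>n. n div K"] K[of b] K[of c] by simp
  ultimately show ?case using snoc z g by (auto simp: inj_on_def)
qed simp

text \<open>Once the values of the prefixes differ, later digits cannot reverse the comparison, as
  equally long remainders have values below the same power of \<open>K\<close>. So the three
  quotients are: decided positively, undecided, decided negatively.\<close>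

lemma fin_index_numval_less:
  fixes p q :: "'b \<Rightarrow> 'a"
  assumes K: "\<And>b. g b < K" shows "fin_index {w. numval g K (map p w) < numval g K (map q w)}"
    (is "fin_index ?M")
proof -
  have lt: "m * K ^ length v + numval g K (map p v) < n * K ^ length v + numval g K (map q v)"
    if "m < n" for m n v and p q :: "'b \<Rightarrow> 'a"
  proof -
    have "m * K ^ length v + numval g K (map p v) < (m + 1) * K ^ length v"
      using numval_less[of g K "map p v"] K by simp
    also have "\<dots> \<le> n * K ^ length v" using that(1) by (intro mult_right_mono) auto
    finally show ?thesis by simp
  qed
  have "quot ?M u \<in> {UNIV, ?M, {}}" for u
  proof (cases "numval g K (map p u)" "numval g K (map q u)" rule: linorder_cases)
    case less
    then have "quot ?M u = UNIV" by (auto simp: quot_def numval_append lt)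
    then show ?thesis by simp
  next
    case equal
    then have "quot ?M u = ?M" by (auto simp: quot_def numval_append)
    then show ?thesis by simp
  next
    case greater
    then have "quot ?M u = {}" by (auto simp: quot_def numval_append not_less lt less_imp_le)
    then show ?thesis by simp
  qed
  then have "range (quot ?M) \<subseteq> {UNIV, ?M, {}}" by (rule image_subsetI)
  then show ?thesis unfolding fin_index_def by (rule finite_subset) simp
qed

text \<open>The elements of \<open>A\<close> other than \<open>c\<close> get the digits from 1 on.
  Letters outside \<open>A\<close> share the digit 0, so that the bound holds for all
  letters.\<close>

lemma ex_digits:
  assumes "finite A" "c \<in> A"
  shows "\<exists>g K. inj_on g A \<and> g c = (0::nat) \<and> (\<forall>b. g b < K)"
proof -
  obtain h where h: "bij_betw h (A - {c}) {0..<card (A - {c})}"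
    using assms(1) ex_bij_betw_finite_nat finite_Diff by blast
  let ?g = "\<lambda>b. if b \<in> A - {c} then Suc (h b) else 0"
  have "inj_on ?g A" using h by (auto simp: inj_on_def bij_betw_def)
  moreover have "?g b < Suc (card (A - {c}))" for b
    using h by (auto simp: bij_betw_def)
  ultimately show ?thesis by (intro exI[of _ ?g] exI[of _ "Suc (card (A - {c}))"]) auto
qed

text \<open>The witness is the value of a word in base \<open>K\<close>; padding does not change it, because the blank
  is the digit 0.\<close>

lemma ex_acceptable_order:
  fixes S :: "'d::finite \<Rightarrow> 'a numeration"
  assumes S: "\<And>j. numeration_system (S j)"
  obtains N :: "('d \<Rightarrow> nat) \<Rightarrow> nat"
    where "inj N" "\<And>a b. acceptable S (\<lambda>x. N (x a) < N (x b))"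
proof -
  have "blank \<in> letters S" by (simp add: letters_def)
  then obtain g :: "('d \<Rightarrow> 'a option) \<Rightarrow> nat" and K
    where g: "inj_on g (letters S)" "g blank = 0" and K: "\<And>b. g b < K"
    using ex_digits[OF finite_letters[of S, OF S]] by blast
  have pad: "numval g K (replicate m blank @ y) = numval g K y" for m y
  proof -
    have "numval g K (replicate m blank) = 0"
    proof (induction m)
      case (Suc m)
      have "replicate (Suc m) (blank :: 'd \<Rightarrow> 'a option) = replicate m blank @ [blank]"
        by (simp add: replicate_append_same)
      with Suc show ?case by (simp only: numval_snoc g)
    qed simp
    then show ?thesis by (simp add: numval_append)
  qed
  have cod: "numval g K y = numval g K (rep S n)" if "codes S y n" for y n
    using that pad by (auto simp: codes_iff)
  show thesis
  proof
    show "inj (\<lambda>n. numval g K (rep S n))"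
    proof (rule injI)
      fix n n' assume eq: "numval g K (rep S n) = numval g K (rep S n')"
      \<comment> \<open>Each word is padded by the length of the other, which gives the common
        length required by \<open>numval_inj\<close>.\<close>
      define y where "y = replicate (length (rep S n')) blank @ rep S n"
      define y' where "y' = replicate (length (rep S n)) blank @ rep S n'"
      have c: "codes S y n" "codes S y' n'" by (auto simp: codes_iff y_def y'_def)
      have "y = y'"
      proof (rule numval_inj[OF K g(1)])
        show "length y = length y'" by (simp add: y_def y'_def)
        show "numval g K y = numval g K y'" using cod c eq by metis
      qed (use c codes_letters[of S, OF S] in auto)
      then show "n = n'" using codes_unique[of S, OF S] c by blast
    qed
    fix a b :: nat
    show "acceptable S (\<lambda>x. numval g K (rep S (x a)) < numval g K (rep S (x b)))"
    proof (rule acceptableI)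
      show "fin_index {w. numval g K (track a w) < numval g K (track b w)}"
        by (rule fin_index_numval_less[OF K])
      fix w and x :: "nat \<Rightarrow> 'd \<Rightarrow> nat" assume "\<And>k. codes S (track k w) (x k)"
      then show "w \<in> {w. numval g K (track a w) < numval g K (track b w)} \<longleftrightarrow>
          numval g K (rep S (x a)) < numval g K (rep S (x b))"
        using cod[of "track a w" "x a"] cod[of "track b w" "x b"] by simp
    qed
  qed
qed

section \<open>Minimal positions of factors\<close>

lemma factor_eq_iff:
  "factor f p s = factor f p' s \<longleftrightarrow>
     (\<forall>i. (\<forall>j. i j < s j) \<longrightarrow> f (\<lambda>j. p j + i j) = f (\<lambda>j. p' j + i j))"
  by (simp add: factor_def restrict_def fun_eq_iff) meson

lemma finite_factors:
  fixes f :: "('d::finite \<Rightarrow> nat) \<Rightarrow> 'k"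
  assumes "finite (range f)" shows "finite (range (\<lambda>p. factor f p s))"
proof (rule finite_subset)
  let ?I = "{i. \<forall>j. i j < s j}"
  have "?I = Pi\<^sub>E UNIV (\<lambda>j. {..<s j})" by (auto simp: PiE_UNIV_domain)
  then have "finite ?I" by (simp add: finite_PiE)
  then show "finite (?I \<rightarrow>\<^sub>E range f)" using assms by (intro finite_PiE)
  show "range (\<lambda>p. factor f p s) \<subseteq> ?I \<rightarrow>\<^sub>E range f"
    by (simp add: factor_def image_subset_iff restrict_PiE_iff)
qed

definition first_occurrences ::
    "(('d \<Rightarrow> nat) \<Rightarrow> nat) \<Rightarrow> (('d \<Rightarrow> nat) \<Rightarrow> 'k) \<Rightarrow> ('d \<Rightarrow> nat) \<Rightarrow> ('d \<Rightarrow> nat) set" where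
  "first_occurrences N f s = {p. \<forall>p'. N p' < N p \<longrightarrow> factor f p' s \<noteq> factor f p s}"

text \<open>Each factor has a position of least \<open>N\<close> because the naturals are
  well-ordered, and injectivity of \<open>N\<close> makes it unique.\<close>

lemma bij_betw_first_occurrences:
  assumes "inj N"
  shows "bij_betw (\<lambda>p. factor f p s) (first_occurrences N f s) (range (\<lambda>p. factor f p s))"
  unfolding bij_betw_def
proof
  show "inj_on (\<lambda>p. factor f p s) (first_occurrences N f s)"
  proof (rule inj_onI)
    fix p q assume "p \<in> first_occurrences N f s" "q \<in> first_occurrences N f s"
      "factor f p s = factor f q s"
    then have "\<not> N p < N q" "\<not> N q < N p" by (auto simp: first_occurrences_def)
    then have "N p = N q" by simp
    then show "p = q" by (rule injD[OF assms])
  qed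
  show "(\<lambda>p. factor f p s) ` first_occurrences N f s = range (\<lambda>p. factor f p s)"
  proof (intro subset_antisym subsetI)
    fix F assume "F \<in> range (\<lambda>p. factor f p s)"
    then obtain q where q: "factor f q s = F" by blast
    let ?p = "arg_min N (\<lambda>p. factor f p s = F)"
    have "factor f ?p s = F" using q by (rule arg_min_natI[where P = "\<lambda>p. factor f p s = F"])
    moreover have "N ?p \<le> N p'" if "factor f p' s = F" for p'
      using that by (rule arg_min_nat_le[where P = "\<lambda>p. factor f p s = F"])
    ultimately have "?p \<in> first_occurrences N f s"
      by (auto simp: first_occurrences_def not_less[symmetric])
    then show "F \<in> (\<lambda>p. factor f p s) ` first_occurrences N f s"
      using \<open>factor f ?p s = F\<close> by (metis image_eqI)
  qed blast
qed

text \<open>Acceptability of values of \<open>f\<close> is available at variables only, so the two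
  sums become existentially quantified variables. Equality of factors is expressed as: no
  \<open>i\<close> below \<open>s\<close> separates them; thus existential quantifiers and negation
  suffice.\<close>

lemma acceptable_first_occurrences:
  fixes S :: "'d::finite \<Rightarrow> 'a numeration"
  assumes S: "\<And>j. numeration_system (S j)" and add: "addition_recognizable S"
    and f: "automatic S f" and N: "\<And>a b. acceptable S (\<lambda>x. N (x a) < N (x b))"
  shows "acceptable S (\<lambda>x. x 1 \<in> first_occurrences N f (x 0))"
proof -
  \<comment> \<open>Variables 0 to 5 stand for \<open>s\<close>, \<open>p\<close>, \<open>p'\<close>, \<open>i\<close>, \<open>p' + i\<close> and \<open>p + i\<close>.\<close>
  define R4 where "R4 x \<longleftrightarrow> (\<forall>j. x 2 j + x 3 j = x 4 j) \<and> (\<forall>j. x 1 j + x 3 j = x 5 j) \<and>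
    f (x 4) \<noteq> f (x 5)" for x :: "nat \<Rightarrow> 'd \<Rightarrow> nat"
  define R3 where "R3 x \<longleftrightarrow> (\<exists>v. R4 (x(5 := v)))" for x
  define R2 where "R2 x \<longleftrightarrow> (\<forall>j. x 3 j < x 0 j) \<and> (\<exists>u. R3 (x(4 := u)))" for x
  define R1 where "R1 x \<longleftrightarrow> N (x 2) < N (x 1) \<and> \<not> (\<exists>i. R2 (x(3 := i)))" for x
  have 4: "acceptable S R4"
    unfolding R4_def by (intro acceptable_conj acceptable_add acceptable_automatic_neq S add f)
  have 3: "acceptable S R3"
    unfolding R3_def by (intro acceptable_ex S 4)
  have 2: "acceptable S R2"
    \<comment> \<open>Here 4 is the scratch variable for the difference; it only has to avoid 3 and
      0.\<close>
    unfolding R2_def by (intro acceptable_conj acceptable_ex acceptable_less[where c = 4] S add 3) auto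
  have 1: "acceptable S R1"
    unfolding R1_def by (intro acceptable_conj acceptable_Not acceptable_ex S N 2)
  have "acceptable S (\<lambda>x. \<not> (\<exists>p'. R1 (x(2 := p'))))"
    by (intro acceptable_Not acceptable_ex S 1)
  moreover have "(\<not> (\<exists>p'. R1 (x(2 := p')))) \<longleftrightarrow> x 1 \<in> first_occurrences N f (x 0)" for x
  proof -
    have R3_iff: "R3 x \<longleftrightarrow> (\<forall>j. x 2 j + x 3 j = x 4 j) \<and> f (x 4) \<noteq> f (\<lambda>j. x 1 j + x 3 j)" for x
    proof
      assume "R3 x"
      then obtain v where v: "\<forall>j. x 2 j + x 3 j = x 4 j" "\<forall>j. x 1 j + x 3 j = v j" "f (x 4) \<noteq> f v"
        by (auto simp: R3_def R4_def)
      then have "v = (\<lambda>j. x 1 j + x 3 j)" by auto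
      with v show "(\<forall>j. x 2 j + x 3 j = x 4 j) \<and> f (x 4) \<noteq> f (\<lambda>j. x 1 j + x 3 j)" by simp
    next
      assume "(\<forall>j. x 2 j + x 3 j = x 4 j) \<and> f (x 4) \<noteq> f (\<lambda>j. x 1 j + x 3 j)"
      then show "R3 x"
        unfolding R3_def R4_def by (intro exI[of _ "\<lambda>j. x 1 j + x 3 j"]) simp
    qed
    have R2_iff: "R2 x \<longleftrightarrow> (\<forall>j. x 3 j < x 0 j) \<and> f (\<lambda>j. x 2 j + x 3 j) \<noteq> f (\<lambda>j. x 1 j + x 3 j)" for x
    proof -
      have "(\<exists>u. R3 (x(4 := u))) \<longleftrightarrow> f (\<lambda>j. x 2 j + x 3 j) \<noteq> f (\<lambda>j. x 1 j + x 3 j)"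
      proof
        assume "\<exists>u. R3 (x(4 := u))"
        then obtain u where u: "\<forall>j. x 2 j + x 3 j = u j" "f u \<noteq> f (\<lambda>j. x 1 j + x 3 j)"
          by (auto simp: R3_iff)
        then have "u = (\<lambda>j. x 2 j + x 3 j)" by auto
        with u show "f (\<lambda>j. x 2 j + x 3 j) \<noteq> f (\<lambda>j. x 1 j + x 3 j)" by simp
      next
        assume "f (\<lambda>j. x 2 j + x 3 j) \<noteq> f (\<lambda>j. x 1 j + x 3 j)"
        then show "\<exists>u. R3 (x(4 := u))"
          by (intro exI[of _ "\<lambda>j. x 2 j + x 3 j"]) (simp add: R3_iff)
      qed
      then show ?thesis by (simp add: R2_def)
    qed
    have "R1 (x(2 := p')) \<longleftrightarrow> N p' < N (x 1) \<and> factor f p' (x 0) = factor f (x 1) (x 0)" for p'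
      by (simp add: R1_def R2_iff factor_eq_iff) blast
    then show ?thesis by (auto simp: first_occurrences_def)
  qed
  ultimately show ?thesis by simp
qed

section \<open>Words coding a pair of vectors\<close>

text \<open>Up to regrouping letters, this is the representation of \<open>(s, p)\<close> in the
  concatenated system of dimension \<open>2d\<close>. Letters are pairs so that the two vectors are
  read off by \<open>map fst\<close> and \<open>map snd\<close>.\<close>

definition pair_word ::
    "('d::finite \<Rightarrow> 'a numeration) \<Rightarrow> ('d \<Rightarrow> nat) \<Rightarrow> ('d \<Rightarrow> nat) \<Rightarrow> (('d \<Rightarrow> 'a option) \<times> ('d \<Rightarrow> 'a option)) list"
  where "pair_word S s p =
    zip (replicate (length (rep S p) - length (rep S s)) blank @ rep S s)
        (replicate (length (rep S s) - length (rep S p)) blank @ rep S p)"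

lemma map_fst_pair_word:
  "map fst (pair_word S s p) = replicate (length (rep S p) - length (rep S s)) blank @ rep S s"
  unfolding pair_word_def by (rule map_fst_zip) simp

lemma map_snd_pair_word:
  "map snd (pair_word S s p) = replicate (length (rep S s) - length (rep S p)) blank @ rep S p"
  unfolding pair_word_def by (rule map_snd_zip) simp

text \<open>Among the padded codes of a pair, exactly one has no leading column blank on both sides.
  This normal form avoids counting a pair infinitely often, and each of its conditions gives
  finitely many quotients.\<close>

lemma eq_pair_word_iff:
  "v = pair_word S s p \<longleftrightarrow>
     codes S (map fst v) s \<and> codes S (map snd v) p \<and> (v = [] \<or> hd v \<noteq> (blank, blank))"
proof
  assume v: "v = pair_word S s p"
  have "codes S (map fst v) s" "codes S (map snd v) p"
    unfolding v map_fst_pair_word map_snd_pair_word codes_iff by blast+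
  moreover have "hd v \<noteq> (blank, blank)" if "v \<noteq> []"
  proof (cases "length (rep S p) \<le> length (rep S s)")
    case True
    then have "map fst v = rep S s" by (simp add: v map_fst_pair_word)
    then have "fst (hd v) \<noteq> blank" using hd_rep[of S s] that by (metis list.map_sel(1) map_is_Nil_conv)
    then show ?thesis by auto
  next
    case False
    then have "map snd v = rep S p" by (simp add: v map_snd_pair_word)
    then have "snd (hd v) \<noteq> blank" using hd_rep[of S p] that by (metis list.map_sel(1) map_is_Nil_conv)
    then show ?thesis by auto
  qed
  ultimately show "codes S (map fst v) s \<and> codes S (map snd v) p \<and> (v = [] \<or> hd v \<noteq> (blank, blank))"
    by blast
next
  assume *: "codes S (map fst v) s \<and> codes S (map snd v) p \<and> (v = [] \<or> hd v \<noteq> (blank, blank))"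
  then obtain k m where km: "map fst v = replicate k blank @ rep S s"
    "map snd v = replicate m blank @ rep S p"
    by (auto simp: codes_iff)
  have len: "length v = k + length (rep S s)" "length v = m + length (rep S p)"
    using km[THEN arg_cong, of length] by simp_all
  have "k = 0 \<or> m = 0"
  proof (rule ccontr)
    assume "\<not> (k = 0 \<or> m = 0)"
    then obtain k' m' where "k = Suc k'" "m = Suc m'" by (metis not0_implies_Suc)
    then have "hd (map fst v) = blank" "hd (map snd v) = blank" "v \<noteq> []" using km len by auto
    then have "hd v = (blank, blank)" by (simp add: hd_map prod_eq_iff)
    then show False using * \<open>v \<noteq> []\<close> by simp
  qed
  then have "k = length (rep S p) - length (rep S s)" "m = length (rep S s) - length (rep S p)"
    using len by auto
  then have "zip (map fst v) (map snd v) = pair_word S s p"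
    unfolding km pair_word_def by simp
  then show "v = pair_word S s p" by (simp add: zip_map_fst_snd)
qed

lemma fin_index_pair_words:
  fixes S :: "'d::finite \<Rightarrow> 'a numeration"
  assumes S: "\<And>j. numeration_system (S j)" and R: "acceptable S (\<lambda>x. R (x 0) (x 1))"
  shows "fin_index {pair_word S s p | s p. R s p}"
proof -
  obtain P where P: "fin_index P"
    "\<And>w (x :: nat \<Rightarrow> 'd \<Rightarrow> nat). (\<forall>k. codes S (track k w) (x k)) \<Longrightarrow> w \<in> P \<longleftrightarrow> R (x 0) (x 1)"
    using R unfolding acceptable_def by blast
  \<comment> \<open>Every variable other than 0 receives the second vector, so that all the
    infinitely many tracks are valid.\<close>
  let ?h = "\<lambda>b k. if k = (0::nat) then fst b else snd b"
  let ?D = "{y. \<exists>n. codes S y n}"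
  let ?M = "{v. map ?h v \<in> P} \<inter> {v. map fst v \<in> ?D} \<inter> {v. map snd v \<in> ?D} \<inter>
    {v. v = [] \<or> hd v \<noteq> (blank, blank)}"
  have P_iff: "map ?h v \<in> P \<longleftrightarrow> R s p" if "codes S (map fst v) s" "codes S (map snd v) p" for v s p
  proof -
    have "codes S (track k (map ?h v)) (if k = 0 then s else p)" for k
      using that by (simp add: comp_def)
    then show ?thesis using P(2)[of "map ?h v" "\<lambda>k. if k = 0 then s else p"] by simp
  qed
  have "v \<in> {pair_word S s p | s p. R s p} \<longleftrightarrow> v \<in> ?M" for v
  proof
    assume "v \<in> {pair_word S s p | s p. R s p}"
    then obtain s p where "v = pair_word S s p" "R s p" by blast
    then show "v \<in> ?M" unfolding eq_pair_word_iff using P_iff[of v s p] by blast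
  next
    assume v: "v \<in> ?M"
    then obtain s p where sp: "codes S (map fst v) s" "codes S (map snd v) p" by blast
    then have "R s p" using P_iff[of v s p] v by blast
    moreover have "v = pair_word S s p" unfolding eq_pair_word_iff using sp v by blast
    ultimately show "v \<in> {pair_word S s p | s p. R s p}" by blast
  qed
  then have "{pair_word S s p | s p. R s p} = ?M" by (rule Set.set_eqI)
  moreover have "fin_index ?M"
    by (intro fin_index_Int fin_index_vimage_map P(1) fin_index_codes S fin_index_hd_neq)
  ultimately show ?thesis by simp
qed

section \<open>Counting the second vector, and the factor complexity\<close>

lemma nat_recognizable_cong:
  "(\<And>w. w \<in> lists B \<Longrightarrow> R w = R' w) \<Longrightarrow> nat_recognizable B R \<longleftrightarrow> nat_recognizable B R'"
  unfolding nat_recognizable_def by simp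

text \<open>Above \<open>rep S s\<close>, with blanks allowed in front, lie exactly the pair words
  of \<open>s\<close> and some \<open>p\<close> with \<open>R s p\<close>, and the second track
  recovers \<open>p\<close>. Above other words over \<open>multi_alphabet S\<close> there are none,
  which yields the value 0 outside the numeration language.\<close>

lemma nat_regular_card:
  fixes S :: "'d::finite \<Rightarrow> 'a numeration"
  assumes S: "\<And>j. numeration_system (S j)" and R: "acceptable S (\<lambda>x. R (x 0) (x 1))"
    and fin: "\<And>s. finite {p. R s p}"
  shows "nat_regular S (\<lambda>s. card {p. R s p})"
proof -
  let ?W = "{pair_word S s p | s p. R s p}"
  let ?C = "\<lambda>w. {v \<in> ?W. \<exists>k. map fst v = replicate k blank @ w}"
  \<comment> \<open>The finiteness condition of \<open>nat_recognizable_card_projection\<close>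
    concerns all \<open>w\<close>, including those with blank letters; hence the use of
    \<open>dropWhile\<close> here and in \<open>empty\<close>.\<close>
  have strip: "\<exists>p. R s p \<and> v = pair_word S s p"
    if v: "v \<in> ?C w" and s: "dropWhile ((=) blank) w = rep S s" for v w s
  proof -
    obtain s' p k where p: "R s' p" "v = pair_word S s' p" "map fst v = replicate k blank @ w"
      using v by blast
    then have "codes S (map fst v) s'" unfolding eq_pair_word_iff by blast
    then have "dropWhile ((=) blank) (replicate k blank @ w) = rep S s'"
      using codes_strip p(3) by metis
    then have "rep S s = rep S s'" using s by (simp add: dropWhile_replicate_append)
    then have "s = s'" using inj_rep[of S, OF S] by (simp add: inj_eq)
    then show ?thesis using p by blast
  qed
  have empty: "?C w = {}" if "dropWhile ((=) blank) w \<notin> range (rep S)" for w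
  proof (rule ccontr)
    assume "?C w \<noteq> {}"
    then obtain s p k where "map fst (pair_word S s p) = replicate k blank @ w" by blast
    moreover have "dropWhile ((=) blank) (map fst (pair_word S s p)) = rep S s"
      by (simp add: map_fst_pair_word codes_strip[unfolded codes_iff])
    ultimately have "dropWhile ((=) blank) w = rep S s" by (simp add: dropWhile_replicate_append)
    then show False using that by blast
  qed
  have rec: "nat_recognizable (multi_alphabet S) (\<lambda>w. card (?C w))"
  proof (rule nat_recognizable_card_projection)
    show "fin_index ?W" by (rule fin_index_pair_words[OF S R])
    show "finite (letters S)" by (rule finite_letters[OF S])
    show "?W \<subseteq> lists (UNIV \<times> letters S)"
    proof
      fix v assume "v \<in> ?W"
      then obtain s p where "v = pair_word S s p" by blast
      then have "codes S (map snd v) p" unfolding eq_pair_word_iff by blast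
      then have "set (map snd v) \<subseteq> letters S" by (rule codes_letters[of S, OF S])
      then show "v \<in> lists (UNIV \<times> letters S)" by (auto simp: mem_Times_iff)
    qed
    show "finite (?C w)" for w
    proof (cases "dropWhile ((=) blank) w \<in> range (rep S)")
      case True
      then obtain s where "dropWhile ((=) blank) w = rep S s" by blast
      then have "?C w \<subseteq> pair_word S s ` {p. R s p}" using strip[of _ w s] by blast
      then show ?thesis using fin[of s] finite_surj by blast
    next
      case False
      then have "?C w = {}" by (rule empty)
      then show ?thesis by (rule ssubst) (rule finite.emptyI)
    qed
  qed
  have eq: "card (?C w) = (if w \<in> multi_lang S then card {p. R (val S w) p} else 0)"
    if "w \<in> lists (multi_alphabet S)" for w
  proof -
    have "blank \<notin> set w" using that by (auto simp: multi_alphabet_def)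
    then have w: "dropWhile ((=) blank) w = w" by (cases w) auto
    show ?thesis
    proof (cases "w \<in> multi_lang S")
      case True
      then obtain s where s: "w = rep S s" using multi_lang_eq_range_rep[of S, OF S] by auto
      have "inj_on (pair_word S s) {p. R s p}"
      proof (rule inj_onI)
        fix p p' assume "pair_word S s p = pair_word S s p'"
        then have "codes S (map snd (pair_word S s p)) p" "codes S (map snd (pair_word S s p)) p'"
          using eq_pair_word_iff by blast+
        then show "p = p'" by (rule codes_unique[of S, OF S])
      qed
      moreover have "?C w = pair_word S s ` {p. R s p}"
      proof
        show "?C w \<subseteq> pair_word S s ` {p. R s p}" using strip[of _ w s] w s by auto
        show "pair_word S s ` {p. R s p} \<subseteq> ?C w" using s map_fst_pair_word[of S s] by blast
      qed
      ultimately have "card (?C w) = card {p. R s p}" by (simp only: card_image)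
      then show ?thesis using True s val_rep[of S, OF S] by simp
    next
      case False
      then have "?C w = {}" using empty[of w] w multi_lang_eq_range_rep[of S, OF S] by simp
      then show ?thesis using False by (simp only: card.empty if_False)
    qed
  qed
  show ?thesis
    unfolding nat_regular_def using nat_recognizable_cong[OF eq] rec by (rule iffD1)
qed

theorem theorem7p12:
  fixes S :: "'d::finite \<Rightarrow> 'a numeration"
  assumes "\<And>j. numeration_system (S j)"
    and "addition_recognizable S"
  shows "\<forall>f :: ('d \<Rightarrow> nat) \<Rightarrow> 'k::{semiring_0,monoid_mult}.
           automatic S f \<longrightarrow> nat_regular S (factor_complexity f)"
proof (intro allI impI)
  fix f :: "('d \<Rightarrow> nat) \<Rightarrow> 'k" assume f: "automatic S f"
  obtain N :: "('d \<Rightarrow> nat) \<Rightarrow> nat"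
    where N: "inj N" "\<And>a b. acceptable S (\<lambda>x. N (x a) < N (x b))"
    using ex_acceptable_order[of S, OF assms(1)] by blast
  have bij: "bij_betw (\<lambda>p. factor f p s) (first_occurrences N f s) (range (\<lambda>p. factor f p s))" for s
    by (rule bij_betw_first_occurrences[OF N(1)])
  have "nat_regular S (\<lambda>s. card {p. p \<in> first_occurrences N f s})"
  proof (rule nat_regular_card[of S, OF assms(1)])
    show "acceptable S (\<lambda>x. x 1 \<in> first_occurrences N f (x 0))"
      by (rule acceptable_first_occurrences[of S, OF assms f N(2)])
    \<comment> \<open>Finite range leaves finitely many factors of size \<open>s\<close>, and the
      bijection transfers this to their first positions.\<close>
    show "finite {p. p \<in> first_occurrences N f s}" for s
      using bij[of s] finite_factors[OF automatic_finite_range[of S, OF assms(1) f], of s]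
      by (simp add: bij_betw_finite)
  qed
  moreover have "(\<lambda>s. card {p. p \<in> first_occurrences N f s}) = factor_complexity f"
    using bij_betw_same_card[OF bij] by (simp add: factor_complexity_def fun_eq_iff)
  ultimately show "nat_regular S (factor_complexity f)" by simp
qed

end
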